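(* Let $R$ be an integral domain with quotient field $K$, $R\neq K$. The following conditions are equivalent: (1) $R$ is a strongly discrete $PvMD$ and a weakly Matlis domain; (2) $R$ is an integrally closed strongly $w$-divisorial domain; (3) $R$ is integrally closed and each $t$-flat overring of $R$ is $w$-divisorial; (4) $R$ is integrally closed and each $t$-linked overring of $R$ is $w$-divisorial; (5) $R$ is a $w$-divisorial generalized Krull domain; (6) $R$ is a generalized Krull domain and each $t$-prime ideal of $R$ is contained in a unique $t$-maximal ideal.
   Context: For a domain $D$ with quotient field $K\neq D$ and fractional ideals $I,J$, put $(J:I)=\{x\in K: xI\subseteq J\}$. For a nonzero fractional ideal $I$ of $D$: $I_v=(D:(D:I))$; $I_t=\bigcup J_v$, the union over nonzero finitely generated fractional ideals $J\subseteq I$. $I$ is divisorial if $I=I_v$, a $t$-ideal if $I=I_t$. A $t$-prime is a nonzero prime ideal that is a $t$-ideal; a $t$-maximal ideal is an ideal maximal among the proper integral $t$-ideals (it is prime). $t\text{-Max}(D)$ and $t\text{-Spec}(D)$ are the sets of $t$-maximal and $t$-prime ideals. $I_w=\bigcap_{M\in t\text{-Max}(D)}ID_M$, and $I$ is a $w$-ideal if $I=I_w$. $D$ is divisorial if every nonzero ideal is divisorial; $w$-divisorial if every $w$-ideal is divisorial; strongly $w$-divisorial if it is $w$-divisorial and $D_P$ is divisorial for each $P\in t\text{-Spec}(D)$. A field is regarded as (trivially) $w$-divisorial. $D$ is weakly Matlis if each nonzero element belongs to at most finitely many $t$-maximal ideals and each $t$-prime is contained in a unique $t$-maximal ideal.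 $D$ is a $PvMD$ if $D_M$ is a valuation domain for each $t$-maximal ideal $M$. A $PvMD$ $D$ is strongly discrete if $(P^2)_t\neq P$ for each $P\in t\text{-Spec}(D)$. A generalized Krull domain is a strongly discrete $PvMD$ in which each (integral) $t$-ideal has only finitely many minimal primes. An overring of $R$ is a ring $T$ with $R\subseteq T\subseteq K$. $T$ is $t$-flat over $R$ if $T_M=R_{M\cap R}$ for each $t$-maximal ideal $M$ of $T$ ($K$ is considered $t$-flat over $R$). $T$ is $t$-linked over $R$ if for each nonzero finitely generated ideal $J$ of $R$ with $(R:J)=R$ one has $(T:JT)=T$. *)

theory Defs
  imports
    Main
    "HOL-Computational_Algebra.Polynomial"
    "HOL-Algebra.Ideal_Product"
begin

text \<open>The quotient field \<open>K\<close> is a type \<open>'a\<close> of class \<open>field\<close>, and \<open>D\<close>, its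
  fractional ideals, its localizations and its overrings are subsets of \<open>'a\<close>. Every
  notion below is meant for \<open>D\<close> a subring of \<open>'a\<close> with quotient field
  \<open>UNIV\<close>; so \<open>D\<close> and all its overrings share the same \<open>K\<close>.\<close>

definition ring_on :: "'a::field set \<Rightarrow> 'a ring" where
  "ring_on D = \<lparr>carrier = D, monoid.mult = (*), one = 1, ring.zero = 0, add = (+)\<rparr>"

definition has_quotient_field :: "'a::field set \<Rightarrow> bool" where
  "has_quotient_field D \<longleftrightarrow> (\<forall>x. \<exists>a\<in>D. \<exists>b\<in>D. b \<noteq> 0 \<and> x = a / b)"

definition overring :: "'a::field set \<Rightarrow> 'a set \<Rightarrow> bool" where
  "overring R T \<longleftrightarrow> ring (ring_on T) \<and> R \<subseteq> T"

definition integrally_closed :: "'a::field set \<Rightarrow> bool" where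
  "integrally_closed D \<longleftrightarrow>
     (\<forall>x. (\<exists>p. lead_coeff p = 1 \<and> (\<forall>i. coeff p i \<in> D) \<and> poly p x = 0) \<longrightarrow> x \<in> D)"

definition valuation_domain :: "'a::field set \<Rightarrow> bool" where
  "valuation_domain D \<longleftrightarrow> domain (ring_on D) \<and> (\<forall>x. x \<noteq> 0 \<longrightarrow> x \<in> D \<or> inverse x \<in> D)"

definition localize :: "'a::field set \<Rightarrow> 'a set \<Rightarrow> 'a set" where
  "localize D P = {a / s |a s. a \<in> D \<and> s \<in> D - P}"

definition submodule_of :: "'a::field set \<Rightarrow> 'a set \<Rightarrow> bool" where
  "submodule_of D I \<longleftrightarrow>
     additive_subgroup I (ring_on UNIV) \<and> (\<forall>d\<in>D. \<forall>x\<in>I. d * x \<in> I)"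

definition fractional_ideal :: "'a::field set \<Rightarrow> 'a set \<Rightarrow> bool" where
  "fractional_ideal D I \<longleftrightarrow>
     submodule_of D I \<and> (\<exists>d\<in>D. d \<noteq> 0 \<and> (\<forall>x\<in>I. d * x \<in> D))"

definition nonzero_fractional_ideal :: "'a::field set \<Rightarrow> 'a set \<Rightarrow> bool" where
  "nonzero_fractional_ideal D I \<longleftrightarrow> fractional_ideal D I \<and> I \<noteq> {0}"

definition finitely_generated :: "'a::field set \<Rightarrow> 'a set \<Rightarrow> bool" where
  "finitely_generated D I \<longleftrightarrow> (\<exists>F. finite F \<and> I = submodule_of D hull F)"

text \<open>\<^const>\<open>ideal_prod\<close> taken in the ring \<open>K\<close> consists of the finite sums of products
  \<open>x * y\<close> with \<open>x \<in> I\<close> and \<open>y \<in> J\<close>; it also serves for the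
  extensions \<open>I D\<^sub>M\<close> and \<open>J T\<close>.\<close>

abbreviation frac_prod :: "'a::field set \<Rightarrow> 'a set \<Rightarrow> 'a set" where
  "frac_prod I J \<equiv> ideal_prod (ring_on UNIV) I J"

definition colon :: "'a::field set \<Rightarrow> 'a set \<Rightarrow> 'a set" where
  "colon J I = {x. \<forall>y\<in>I. x * y \<in> J}"

definition v_closure :: "'a::field set \<Rightarrow> 'a set \<Rightarrow> 'a set" where
  "v_closure D I = colon D (colon D I)"

definition t_closure :: "'a::field set \<Rightarrow> 'a set \<Rightarrow> 'a set" where
  "t_closure D I = \<Union> {v_closure D J |J.
     nonzero_fractional_ideal D J \<and> finitely_generated D J \<and> J \<subseteq> I}"

definition divisorial_ideal :: "'a::field set \<Rightarrow> 'a set \<Rightarrow> bool" where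
  "divisorial_ideal D I \<longleftrightarrow> nonzero_fractional_ideal D I \<and> v_closure D I = I"

definition t_ideal :: "'a::field set \<Rightarrow> 'a set \<Rightarrow> bool" where
  "t_ideal D I \<longleftrightarrow> nonzero_fractional_ideal D I \<and> t_closure D I = I"

definition t_Spec :: "'a::field set \<Rightarrow> 'a set set" where
  "t_Spec D = {P. primeideal P (ring_on D) \<and> t_ideal D P}"

definition t_Max :: "'a::field set \<Rightarrow> 'a set set" where
  "t_Max D = {M. t_ideal D M \<and> M \<subset> D \<and> (\<forall>J. t_ideal D J \<and> J \<subset> D \<and> M \<subseteq> J \<longrightarrow> J = M)}"

text \<open>If \<open>D = K\<close> then \<^term>\<open>t_Max D\<close> is empty and the intersection below is
  \<^term>\<open>UNIV\<close>, that is, \<open>K\<close>.\<close>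

definition w_closure :: "'a::field set \<Rightarrow> 'a set \<Rightarrow> 'a set" where
  "w_closure D I = (\<Inter>M\<in>t_Max D. frac_prod I (localize D M))"

definition w_ideal :: "'a::field set \<Rightarrow> 'a set \<Rightarrow> bool" where
  "w_ideal D I \<longleftrightarrow> nonzero_fractional_ideal D I \<and> w_closure D I = I"

definition divisorial_domain :: "'a::field set \<Rightarrow> bool" where
  "divisorial_domain D \<longleftrightarrow> (\<forall>I. ideal I (ring_on D) \<and> I \<noteq> {0} \<longrightarrow> divisorial_ideal D I)"

definition w_divisorial :: "'a::field set \<Rightarrow> bool" where
  "w_divisorial D \<longleftrightarrow> field (ring_on D) \<or> (\<forall>I. w_ideal D I \<longrightarrow> divisorial_ideal D I)"

definition strongly_w_divisorial :: "'a::field set \<Rightarrow> bool" where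
  "strongly_w_divisorial D \<longleftrightarrow>
     w_divisorial D \<and> (\<forall>P\<in>t_Spec D. divisorial_domain (localize D P))"

definition t_primes_in_unique_t_maximal :: "'a::field set \<Rightarrow> bool" where
  "t_primes_in_unique_t_maximal D \<longleftrightarrow> (\<forall>P\<in>t_Spec D. \<exists>!M. M \<in> t_Max D \<and> P \<subseteq> M)"

definition weakly_Matlis :: "'a::field set \<Rightarrow> bool" where
  "weakly_Matlis D \<longleftrightarrow>
     (\<forall>x\<in>D. x \<noteq> 0 \<longrightarrow> finite {M \<in> t_Max D. x \<in> M}) \<and> t_primes_in_unique_t_maximal D"

definition PvMD :: "'a::field set \<Rightarrow> bool" where
  "PvMD D \<longleftrightarrow> (\<forall>M\<in>t_Max D. valuation_domain (localize D M))"

definition strongly_discrete_PvMD :: "'a::field set \<Rightarrow> bool" where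
  "strongly_discrete_PvMD D \<longleftrightarrow>
     PvMD D \<and> (\<forall>P\<in>t_Spec D. t_closure D (frac_prod P P) \<noteq> P)"

definition minimal_primes :: "'a::field set \<Rightarrow> 'a set \<Rightarrow> 'a set set" where
  "minimal_primes D I = {P. primeideal P (ring_on D) \<and> I \<subseteq> P \<and>
     (\<forall>Q. primeideal Q (ring_on D) \<and> I \<subseteq> Q \<and> Q \<subseteq> P \<longrightarrow> Q = P)}"

definition generalized_Krull :: "'a::field set \<Rightarrow> bool" where
  "generalized_Krull D \<longleftrightarrow> strongly_discrete_PvMD D \<and>
     (\<forall>I. t_ideal D I \<and> I \<subseteq> D \<longrightarrow> finite (minimal_primes D I))"

definition t_flat :: "'a::field set \<Rightarrow> 'a set \<Rightarrow> bool" where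
  "t_flat R T \<longleftrightarrow> T = UNIV \<or> (\<forall>M\<in>t_Max T. localize T M = localize R (M \<inter> R))"

definition t_linked :: "'a::field set \<Rightarrow> 'a set \<Rightarrow> bool" where
  "t_linked R T \<longleftrightarrow>
     (\<forall>J. ideal J (ring_on R) \<and> J \<noteq> {0} \<and> finitely_generated R J \<and> colon R J = R
        \<longrightarrow> colon T (frac_prod J T) = T)"

end

theory Submission
  imports Defs
begin

text \<open>Everything is tested locally: if for every \<open>t\<close>-maximal \<open>M\<close> some
  \<open>s \<notin> M\<close> satisfies \<open>s x \<in> I\<close>, then \<open>F x \<subseteq> I\<close> for a finite
  \<open>F\<close> with \<open>1 \<in> F\<^sub>v\<close>.

  A strongly discrete \<open>PvMD\<close> is one whose localizations at \<open>t\<close>-primes are valuation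
  domains with principal maximal ideal. If moreover \<open>D\<close> is weakly Matlis, an element outside a
  \<open>w\<close>-ideal \<open>I\<close> is separated from \<open>I\<close> at one \<open>M\<close> by a multiplier that is regular
  at all the other \<open>t\<close>-maximal ideals, so \<open>I\<close> is divisorial; and both hypotheses pass to
  \<open>t\<close>-linked overrings, whose \<open>t\<close>-maximal localizations are localizations of \<open>D\<close> at
  \<open>t\<close>-primes.

  Conversely, integrally closed and \<open>w\<close>-divisorial imply \<open>PvMD\<close>, since two-generated ideals
  are \<open>t\<close>-invertible, and duality between \<open>w\<close>-ideals then forces independence and finiteness
  of the \<open>t\<close>-maximal ideals. Divisoriality of the localizations makes their maximal ideals
  principal.

  The link with generalized Krull domains is that the minimal primes of a \<open>t\<close>-ideal \<open>I\<close> are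
  the traces on \<open>D\<close> of the radicals of \<open>I D\<^sub>M\<close>.\<close>

section \<open>Subrings of a field\<close>

text \<open>All rings involved are subsets of one field, so the locale \<open>frac_dom\<close> is
  interpreted at D_P and at overrings T, and facts proved for D are reused there. The price is the
  exclusion of K itself, which has no t-maximal ideals and is treated by hand. Value groups do not
  occur. Divisibility in D_M is an equation u * x = r * y with u in D - M, and such equations from
  different localizations can be multiplied and cancelled in K. Why a divisorial maximal ideal N of
  a valuation domain V is principal: 1 is not in N = N_v, so some x outside V satisfies x N
  \<subseteq> V; then 1 / x lies in N and N = (1 / x) V. Under (2) N is divisorial like any nonzero
  ideal of D_P, but (3) speaks only of w-ideals, so there N must first be seen to be one. This works
  because finitely generated ideals of V are principal: no finite subset of N has 1 in its
  v-closure, so N lies in a t-maximal ideal of V, and denominators outside it are units.\<close>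

lemma ring_on_sel [simp]:
  "carrier (ring_on D) = D" "x \<otimes>\<^bsub>ring_on D\<^esub> y = x * y" "\<one>\<^bsub>ring_on D\<^esub> = 1"
  "\<zero>\<^bsub>ring_on D\<^esub> = 0" "x \<oplus>\<^bsub>ring_on D\<^esub> y = x + y"
  by (simp_all add: ring_on_def)

lemma ring_onD:
  fixes D :: "'a::field set"
  assumes "ring (ring_on D)"
  shows "0 \<in> D" "1 \<in> D" "x \<in> D \<Longrightarrow> y \<in> D \<Longrightarrow> x + y \<in> D" "x \<in> D \<Longrightarrow> y \<in> D \<Longrightarrow> x * y \<in> D"
    "x \<in> D \<Longrightarrow> - x \<in> D"
proof -
  interpret ring "ring_on D" by fact
  show "0 \<in> D" "1 \<in> D" using zero_closed one_closed by simp_all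
  show "x \<in> D \<Longrightarrow> y \<in> D \<Longrightarrow> x + y \<in> D" using a_closed[of x y] by simp
  show "x \<in> D \<Longrightarrow> y \<in> D \<Longrightarrow> x * y \<in> D" using m_closed[of x y] by simp
  assume "x \<in> D"
  then have "\<ominus>\<^bsub>ring_on D\<^esub> x \<in> D" "x + \<ominus>\<^bsub>ring_on D\<^esub> x = 0"
    using a_inv_closed[of x] r_neg[of x] by simp_all
  then show "- x \<in> D" by (metis eq_neg_iff_add_eq_0 add.commute)
qed

lemma domain_ring_on:
  fixes D :: "'a::field set"
  assumes "0 \<in> D" "1 \<in> D" "\<And>x y. x \<in> D \<Longrightarrow> y \<in> D \<Longrightarrow> x + y \<in> D"
    "\<And>x y. x \<in> D \<Longrightarrow> y \<in> D \<Longrightarrow> x * y \<in> D" "\<And>x. x \<in> D \<Longrightarrow> - x \<in> D"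
  shows "domain (ring_on D)"
proof -
  have "cring (ring_on D)"
  proof (rule cringI)
    show "abelian_group (ring_on D)"
      using assms by (intro abelian_groupI) (auto simp: algebra_simps intro!: bexI[of _ "- x" for x])
    show "comm_monoid (ring_on D)"
      using assms by (intro comm_monoidI) (auto simp: algebra_simps)
  qed (simp add: algebra_simps)
  then show ?thesis
    by (intro domain.intro domain_axioms.intro) auto
qed

locale frac_dom =
  fixes D :: "'a::field set"
  assumes zero_mem [simp]: "0 \<in> D" and one_mem [simp]: "1 \<in> D"
    and add_mem: "x \<in> D \<Longrightarrow> y \<in> D \<Longrightarrow> x + y \<in> D"
    and mult_mem: "x \<in> D \<Longrightarrow> y \<in> D \<Longrightarrow> x * y \<in> D"
    and uminus_mem: "x \<in> D \<Longrightarrow> - x \<in> D"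
    and quotient: "\<exists>a\<in>D. \<exists>b\<in>D. b \<noteq> 0 \<and> x = a / b"
    and proper: "D \<noteq> UNIV"

lemma frac_domI:
  assumes "ring (ring_on T)" "has_quotient_field T" "T \<noteq> UNIV"
  shows "frac_dom T"
  using ring_onD[OF assms(1)] assms(2,3) by unfold_locales (auto simp: has_quotient_field_def)

lemma inv_add_ring_on:
  fixes D :: "'a::field set"
  assumes "ring (ring_on D)" "x \<in> D"
  shows "inv\<^bsub>add_monoid (ring_on D)\<^esub> x = - x"
proof -
  interpret ring "ring_on D" by fact
  have "- x \<in> D" using ring_onD(5)[OF assms] .
  then have "\<ominus>\<^bsub>ring_on D\<^esub> x = - x" using assms(2) minus_equality[of "- x" x] by simp
  then show ?thesis by (simp add: a_inv_def)
qed

context frac_dom begin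

lemma diff_mem: "x \<in> D \<Longrightarrow> y \<in> D \<Longrightarrow> x - y \<in> D"
  using add_mem[of x "- y"] uminus_mem by simp

lemma power_mem: "x \<in> D \<Longrightarrow> x ^ n \<in> D"
  by (induction n) (auto intro: mult_mem)

lemma sum_mem: "(\<And>i. f i \<in> D) \<Longrightarrow> sum f S \<in> D"
  by (induction S rule: infinite_finite_induct) (auto intro: add_mem)

lemma domain_D: "domain (ring_on D)"
  by (intro domain_ring_on) (auto intro: add_mem mult_mem uminus_mem)

lemma cring_D: "cring (ring_on D)" and ring_D: "ring (ring_on D)"
  using domain_D by (simp_all add: domain_def cring_def)

lemma submodule_iff:
  "submodule_of D I \<longleftrightarrow> 0 \<in> I \<and> (\<forall>x\<in>I. \<forall>y\<in>I. x + y \<in> I) \<and> (\<forall>d\<in>D. \<forall>x\<in>I. d * x \<in> I)"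
proof -
  have R: "ring (ring_on (UNIV :: 'a set))"
    using domain_ring_on[of "UNIV :: 'a set"] by (simp add: domain_def cring_def)
  have "- x \<in> I" if "\<forall>d\<in>D. \<forall>x\<in>I. d * x \<in> I" "x \<in> I" for x
    using that uminus_mem[of 1] by force
  then show ?thesis
    by (auto simp: submodule_of_def additive_subgroup_def subgroup_def R inv_add_ring_on[OF R, simplified])
qed

lemma submoduleD:
  assumes "submodule_of D I"
  shows "0 \<in> I" "x \<in> I \<Longrightarrow> y \<in> I \<Longrightarrow> x + y \<in> I" "d \<in> D \<Longrightarrow> x \<in> I \<Longrightarrow> d * x \<in> I"
    "d \<in> D \<Longrightarrow> x \<in> I \<Longrightarrow> x * d \<in> I"
  using assms by (auto simp: submodule_iff mult.commute)

lemma ideal_iff: "ideal I (ring_on D) \<longleftrightarrow> submodule_of D I \<and> I \<subseteq> D"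
proof
  assume "ideal I (ring_on D)"
  then interpret ideal I "ring_on D" .
  have "0 \<in> I" using additive_subgroup.zero_closed[OF is_additive_subgroup] by simp
  moreover have "x + y \<in> I" if "x \<in> I" "y \<in> I" for x y
    using additive_subgroup.a_closed[OF is_additive_subgroup that] by simp
  moreover have "d * x \<in> I" if "x \<in> I" "d \<in> D" for x d
    using I_l_closed[of x d] that by simp
  ultimately show "submodule_of D I \<and> I \<subseteq> D"
    using a_subset by (simp add: submodule_iff)
next
  assume I: "submodule_of D I \<and> I \<subseteq> D"
  have "- x \<in> I" if "x \<in> I" for x
    using that I uminus_mem[of 1] by (force simp: submodule_iff)
  then have "subgroup I (add_monoid (ring_on D))"
    using I ring_D by (auto simp: subgroup_def submodule_iff subset_iff inv_add_ring_on[OF ring_D, simplified])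
  with I ring_D show "ideal I (ring_on D)"
    by (intro idealI) (auto intro: submoduleD)
qed

lemma primeideal_iff: "primeideal P (ring_on D) \<longleftrightarrow>
  submodule_of D P \<and> P \<subseteq> D \<and> 1 \<notin> P \<and> (\<forall>a\<in>D. \<forall>b\<in>D. a * b \<in> P \<longrightarrow> a \<in> P \<or> b \<in> P)"
proof
  assume "primeideal P (ring_on D)"
  then interpret primeideal P "ring_on D" .
  have "1 \<notin> P" using one_imp_carrier I_notcarr by auto
  then show "submodule_of D P \<and> P \<subseteq> D \<and> 1 \<notin> P \<and> (\<forall>a\<in>D. \<forall>b\<in>D. a * b \<in> P \<longrightarrow> a \<in> P \<or> b \<in> P)"
    using is_ideal I_prime by (auto simp: ideal_iff)
next
  assume P: "submodule_of D P \<and> P \<subseteq> D \<and> 1 \<notin> P \<and> (\<forall>a\<in>D. \<forall>b\<in>D. a * b \<in> P \<longrightarrow> a \<in> P \<or> b \<in> P)"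
  then have "D \<noteq> P" using one_mem by blast
  with P show "primeideal P (ring_on D)"
    by (intro primeidealI) (auto simp: ideal_iff cring_D)
qed

lemma primeD:
  assumes "primeideal P (ring_on D)"
  shows "submodule_of D P" "P \<subseteq> D" "1 \<notin> P" "a \<in> D \<Longrightarrow> b \<in> D \<Longrightarrow> a * b \<in> P \<Longrightarrow> a \<in> P \<or> b \<in> P"
    "0 \<in> P" "a \<in> P \<Longrightarrow> b \<in> P \<Longrightarrow> a + b \<in> P" "d \<in> D \<Longrightarrow> a \<in> P \<Longrightarrow> d * a \<in> P"
    "d \<in> D \<Longrightarrow> a \<in> P \<Longrightarrow> a * d \<in> P" "a \<in> P \<Longrightarrow> a \<in> D"
    "s \<in> D - P \<Longrightarrow> u \<in> D - P \<Longrightarrow> s * u \<in> D - P" "1 \<in> D - P" "s \<in> D - P \<Longrightarrow> s \<noteq> 0"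
  using assms by (auto simp: primeideal_iff submodule_iff subset_iff mult.commute mult_mem)

text \<open>With \<open>0 \<in> P\<close> no denominator is 0; otherwise s = 0 would make the
  right-hand side hold for every x.\<close>

lemma localize_iff:
  assumes "0 \<in> P"
  shows "x \<in> localize D P \<longleftrightarrow> (\<exists>s\<in>D - P. s * x \<in> D)"
proof
  assume "x \<in> localize D P"
  then obtain a s where "x = a / s" "a \<in> D" "s \<in> D - P" by (auto simp: localize_def)
  moreover from this assms have "s \<noteq> 0" by auto
  ultimately show "\<exists>s\<in>D - P. s * x \<in> D" by (auto intro!: bexI[of _ s])
next
  assume "\<exists>s\<in>D - P. s * x \<in> D"
  then obtain s where s: "s \<in> D - P" "s * x \<in> D" by auto
  with assms have "s \<noteq> 0" by auto
  then have "x = (s * x) / s" by simp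
  with s show "x \<in> localize D P" unfolding localize_def by blast
qed

lemma D_subset_localize: "1 \<notin> P \<Longrightarrow> D \<subseteq> localize D P"
  by (force simp: localize_def intro: exI[of _ 1])

text \<open>A finite sum of products has a common denominator outside the prime; conversely x = (s *
  x) * (1 / s). Extensions to D_P thus become conditions on single elements.\<close>

lemma frac_prod_localize:
  assumes P: "primeideal P (ring_on D)" and I: "submodule_of D I"
  shows "x \<in> frac_prod I (localize D P) \<longleftrightarrow> (\<exists>s\<in>D - P. s * x \<in> I)"
proof
  assume "x \<in> frac_prod I (localize D P)"
  then show "\<exists>s\<in>D - P. s * x \<in> I"
  proof induction
    case (prod i j)
    then obtain s where s: "s \<in> D - P" "s * j \<in> D" using localize_iff primeD(5)[OF P] by blast
    then have "s * (i * j) \<in> I" using submoduleD(3)[OF I s(2) prod(1)] by (simp add: mult_ac)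
    with s show ?case by auto
  next
    case (sum x y)
    then obtain s u where su: "s \<in> D - P" "u \<in> D - P" "s * x \<in> I" "u * y \<in> I" by auto
    then have "u * (s * x) + s * (u * y) \<in> I"
      using submoduleD(2)[OF I submoduleD(3)[OF I] submoduleD(3)[OF I]] by blast
    with primeD(10)[OF P su(1,2)] show ?case by (auto simp: algebra_simps intro!: bexI[of _ "s * u"])
  qed
next
  assume "\<exists>s\<in>D - P. s * x \<in> I"
  then obtain s where s: "s \<in> D - P" "s * x \<in> I" by auto
  then have "s \<noteq> 0" using primeD(12)[OF P] by auto
  moreover have "1 / s \<in> localize D P" unfolding localize_def
    by (rule CollectI, intro exI[of _ 1] exI[of _ s]) (use s in simp)
  ultimately show "x \<in> frac_prod I (localize D P)"
    using ideal_prod.prod[OF s(2), of "1 / s" "localize D P" "ring_on UNIV"] by simp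
qed

lemma frac_dom_localize:
  assumes P: "primeideal P (ring_on D)" and "P \<noteq> {0}"
  shows "frac_dom (localize D P)"
proof -
  note iff = localize_iff[OF primeD(5)[OF P]]
  have sub: "D \<subseteq> localize D P" using D_subset_localize primeD(3)[OF P] by blast
  show ?thesis
  proof
    show "0 \<in> localize D P" "1 \<in> localize D P" using sub by auto
    show "\<exists>a\<in>localize D P. \<exists>b\<in>localize D P. b \<noteq> 0 \<and> x = a / b" for x
      using quotient[of x] sub by blast
    fix x y assume "x \<in> localize D P"
    then obtain s where s: "s \<in> D - P" "s * x \<in> D" by (auto simp: iff)
    show "- x \<in> localize D P"
      using s uminus_mem[OF s(2)] by (auto simp: iff intro!: bexI[of _ s])
    assume "y \<in> localize D P"
    then obtain u where u: "u \<in> D - P" "u * y \<in> D" by (auto simp: iff)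
    have "u * (s * x) + s * (u * y) \<in> D" "(s * x) * (u * y) \<in> D"
      using s u by (auto intro!: add_mem mult_mem)
    with primeD(10)[OF P s(1) u(1)] show "x + y \<in> localize D P" "x * y \<in> localize D P"
      unfolding iff by (auto intro!: bexI[of _ "s * u"] simp: algebra_simps)
  next
    obtain p where p: "p \<in> P" "p \<noteq> 0" using assms(2) primeD(5)[OF P] by blast
    have "1 / p \<notin> localize D P"
    proof
      assume "1 / p \<in> localize D P"
      then obtain s where s: "s \<in> D - P" "s * (1 / p) \<in> D" by (auto simp: iff)
      then have "(s * (1 / p)) * p \<in> P" using primeD(7)[OF P] p by blast
      with s p show False by simp
    qed
    then show "localize D P \<noteq> UNIV" by auto
  qed
qed


abbreviation "prime_of P \<equiv> primeideal P (ring_on D)"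

section \<open>Divisorial closures and \<open>t\<close>-maximal ideals\<close>

text \<open>The set F is arbitrary, so that finite generating sets can be used directly;
  \<open>v_closure_hull\<close> shows that the generated submodule has the same closure.\<close>

lemma v_closure_iff: "x \<in> v_closure D F \<longleftrightarrow> (\<forall>c. (\<forall>f\<in>F. c * f \<in> D) \<longrightarrow> c * x \<in> D)"
  by (auto simp: v_closure_def colon_def mult.commute)

lemma subset_v_closure: "F \<subseteq> v_closure D F"
  by (auto simp: v_closure_iff)

lemma v_closure_mono: "F \<subseteq> G \<Longrightarrow> v_closure D F \<subseteq> v_closure D G"
  by (auto simp: v_closure_iff subset_iff)

lemma v_closure_trans: "x \<in> v_closure D F \<Longrightarrow> F \<subseteq> v_closure D G \<Longrightarrow> x \<in> v_closure D G"
  unfolding v_closure_iff subset_iff by blast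

lemma v_closure_scale: "x \<in> v_closure D F \<Longrightarrow> c * x \<in> v_closure D ((*) c ` F)"
  unfolding v_closure_iff
proof (intro allI impI)
  fix d assume "\<forall>d. (\<forall>f\<in>F. d * f \<in> D) \<longrightarrow> d * x \<in> D" "\<forall>f\<in>(*) c ` F. d * f \<in> D"
  then have "(d * c) * x \<in> D" by (metis imageI mult.assoc)
  then show "d * (c * x) \<in> D" by (simp add: mult.assoc)
qed

lemma submodule_v_closure: "submodule_of D (v_closure D F)"
  by (auto simp: submodule_iff v_closure_iff ring_distribs mult.left_commute add_mem mult_mem)

lemma submodule_multiples: "submodule_of D {x. x * c \<in> D}"
  by (auto simp: submodule_iff ring_distribs mult.assoc add_mem mult_mem)

lemma submodule_principal: "submodule_of D ((*) c ` D)"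
  unfolding submodule_iff
  by (auto simp: ring_distribs[symmetric] mult.left_commute[of _ c] intro: add_mem mult_mem)

lemma v_closure_subset_principal:
  assumes "F \<subseteq> (*) c ` D"
  shows "v_closure D F \<subseteq> (*) c ` D"
proof (cases "c = 0")
  case True
  \<comment> \<open>Here F is contained in {0}, so every multiplier is admissible, and y / x moves a
    nonzero x out of D.\<close>
  obtain y where y: "y \<notin> D" using proper by blast
  have "x = 0" if "x \<in> v_closure D F" for x
  proof (rule ccontr)
    assume "x \<noteq> 0"
    have "(y / x) * x \<in> D"
      using that True assms unfolding v_closure_iff by (elim allE[of _ "y / x"]) auto
    with \<open>x \<noteq> 0\<close> y show False by simp
  qed
  moreover have "0 \<in> (*) c ` D" by (auto intro: image_eqI[of _ _ 0])
  ultimately show ?thesis by blast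
next
  case False
  show ?thesis
  proof
    fix x assume "x \<in> v_closure D F"
    then have "(1 / c) * x \<in> D"
      using False assms unfolding v_closure_iff by (elim allE[of _ "1 / c"]) auto
    then have "c * ((1 / c) * x) \<in> (*) c ` D" by blast
    with False show "x \<in> (*) c ` D" by simp
  qed
qed

lemma fractional_subset:
  assumes "fractional_ideal D I" "submodule_of D J" "J \<subseteq> I"
  shows "fractional_ideal D J"
  using assms by (auto simp: fractional_ideal_def)

lemma hull_least: "submodule_of D I \<Longrightarrow> F \<subseteq> I \<Longrightarrow> submodule_of D hull F \<subseteq> I"
  by (simp add: hull_minimal)

lemma submodule_hull: "submodule_of D (submodule_of D hull F)"
  by (rule hull_in) (auto simp: submodule_iff)

lemma v_closure_hull: "v_closure D (submodule_of D hull F) = v_closure D F"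
proof
  have "submodule_of D hull F \<subseteq> v_closure D F"
    by (rule hull_least[OF submodule_v_closure subset_v_closure])
  then show "v_closure D (submodule_of D hull F) \<subseteq> v_closure D F"
    using v_closure_trans by blast
qed (rule v_closure_mono[OF hull_subset])

lemma t_closure_iff:
  assumes "nonzero_fractional_ideal D I"
  shows "x \<in> t_closure D I \<longleftrightarrow> (\<exists>F. finite F \<and> F \<subseteq> I \<and> x \<in> v_closure D F)"
proof
  assume "x \<in> t_closure D I"
  then obtain J F where "x \<in> v_closure D J" "J \<subseteq> I" "finite F" "J = submodule_of D hull F"
    by (auto simp: t_closure_def finitely_generated_def)
  then show "\<exists>F. finite F \<and> F \<subseteq> I \<and> x \<in> v_closure D F"
    using hull_subset[of F] by (auto simp: v_closure_hull)
next
  assume "\<exists>F. finite F \<and> F \<subseteq> I \<and> x \<in> v_closure D F"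
  then obtain F where F: "finite F" "F \<subseteq> I" "x \<in> v_closure D F" by blast
  have I: "fractional_ideal D I" "submodule_of D I" "I \<noteq> {0}"
    using assms by (auto simp: nonzero_fractional_ideal_def fractional_ideal_def)
  \<comment> \<open>The definition admits only nonzero J, so a nonzero element is added to F, which
    may be empty or {0}.\<close>
  then obtain a where a: "a \<in> I" "a \<noteq> 0" using submoduleD(1)[OF I(2)] by blast
  let ?J = "submodule_of D hull (insert a F)"
  have "insert a F \<subseteq> ?J" by (rule hull_subset)
  then have "?J \<noteq> {0}" using a by blast
  moreover have "?J \<subseteq> I" using F a by (intro hull_least I) auto
  moreover have "x \<in> v_closure D ?J"
    using F(3) v_closure_mono[of F "insert a F"] by (auto simp: v_closure_hull)
  moreover have "finitely_generated D ?J" using F(1) by (auto simp: finitely_generated_def)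
  moreover have "fractional_ideal D ?J"
    using fractional_subset[OF I(1) submodule_hull \<open>?J \<subseteq> I\<close>] .
  ultimately show "x \<in> t_closure D I"
    unfolding t_closure_def nonzero_fractional_ideal_def by blast
qed

lemma subset_t_closure: "nonzero_fractional_ideal D I \<Longrightarrow> I \<subseteq> t_closure D I"
  using subset_v_closure[of "{x}" for x] by (force simp: t_closure_iff)

lemma finite_subset_t_closure:
  assumes I: "nonzero_fractional_ideal D I" and "finite F" "F \<subseteq> t_closure D I"
  shows "\<exists>G. finite G \<and> G \<subseteq> I \<and> F \<subseteq> v_closure D G"
  using assms(2,3)
proof (induction F)
  case (insert x F)
  then obtain G H where "finite G" "G \<subseteq> I" "F \<subseteq> v_closure D G"
    "finite H" "H \<subseteq> I" "x \<in> v_closure D H" by (auto simp: t_closure_iff[OF I])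
  then show ?case
    using v_closure_mono[of G "G \<union> H"] v_closure_mono[of H "G \<union> H"]
    by (intro exI[of _ "G \<union> H"]) auto
qed auto

lemma fractional_integral: "submodule_of D I \<Longrightarrow> I \<subseteq> D \<Longrightarrow> fractional_ideal D I"
  by (auto simp: fractional_ideal_def intro!: bexI[of _ 1])

lemma submodule_t_closure:
  assumes "nonzero_fractional_ideal D I"
  shows "submodule_of D (t_closure D I)"
proof -
  have I: "submodule_of D I" using assms by (auto simp: nonzero_fractional_ideal_def fractional_ideal_def)
  have "\<exists>F. finite F \<and> F \<subseteq> I \<and> x + y \<in> v_closure D F"
    if "x \<in> v_closure D F" "y \<in> v_closure D G" "finite F" "F \<subseteq> I" "finite G" "G \<subseteq> I" for x y F G
    using that v_closure_mono[of F "F \<union> G"] v_closure_mono[of G "F \<union> G"]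
    by (intro exI[of _ "F \<union> G"]) (auto intro!: submoduleD(2)[OF submodule_v_closure])
  moreover have "0 \<in> t_closure D I" using subset_t_closure[OF assms] submoduleD(1)[OF I] by blast
  moreover have "d * x \<in> t_closure D I" if "d \<in> D" "x \<in> t_closure D I" for d x
    using that submoduleD(3)[OF submodule_v_closure] unfolding t_closure_iff[OF assms] by metis
  ultimately show ?thesis
    unfolding submodule_iff using t_closure_iff[OF assms] by metis
qed

lemma t_idealD:
  assumes "t_ideal D I"
  shows "submodule_of D I" "I \<noteq> {0}" "finite F \<Longrightarrow> F \<subseteq> I \<Longrightarrow> v_closure D F \<subseteq> I"
proof -
  have I: "nonzero_fractional_ideal D I" using assms by (simp add: t_ideal_def)
  then show "submodule_of D I" "I \<noteq> {0}"
    by (auto simp: nonzero_fractional_ideal_def fractional_ideal_def)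
  show "finite F \<Longrightarrow> F \<subseteq> I \<Longrightarrow> v_closure D F \<subseteq> I"
    using assms t_closure_iff[OF I] unfolding t_ideal_def by blast
qed

lemma t_idealI:
  assumes "submodule_of D I" "I \<subseteq> D" "I \<noteq> {0}"
    and "\<And>F x. finite F \<Longrightarrow> F \<subseteq> I \<Longrightarrow> x \<in> v_closure D F \<Longrightarrow> x \<in> I"
  shows "t_ideal D I"
proof -
  have I: "nonzero_fractional_ideal D I"
    using assms by (simp add: nonzero_fractional_ideal_def fractional_integral)
  then have "t_closure D I \<subseteq> I" using assms(4) by (auto simp: t_closure_iff)
  with I subset_t_closure[OF I] show ?thesis by (simp add: t_ideal_def)
qed

lemma t_ideal_principal:
  assumes "a \<in> D" "a \<noteq> 0"
  shows "t_ideal D ((*) a ` D)"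
proof (rule t_idealI[OF submodule_principal])
  have "a * 1 \<in> (*) a ` D" by (rule imageI) simp
  then show "(*) a ` D \<noteq> {0}" using assms by auto
  show "(*) a ` D \<subseteq> D" using assms mult_mem by blast
  show "x \<in> (*) a ` D" if "F \<subseteq> (*) a ` D" "x \<in> v_closure D F" for F x
    using v_closure_subset_principal[OF that(1)] that(2) by blast
qed

lemma v_closure_subset_D: "F \<subseteq> D \<Longrightarrow> v_closure D F \<subseteq> D"
  using v_closure_subset_principal[of F 1] by simp

lemma t_maxD:
  assumes "M \<in> t_Max D"
  shows "t_ideal D M" "submodule_of D M" "M \<noteq> {0}" "M \<subseteq> D" "1 \<notin> M"
    "t_ideal D J \<Longrightarrow> J \<subseteq> D \<Longrightarrow> 1 \<notin> J \<Longrightarrow> M \<subseteq> J \<Longrightarrow> J = M"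
proof -
  show M: "t_ideal D M" "M \<subseteq> D" using assms by (auto simp: t_Max_def)
  then show M': "submodule_of D M" "M \<noteq> {0}" using t_idealD by blast+
  show "1 \<notin> M" using assms submoduleD(4)[OF M'(1), of _ 1] by (auto simp: t_Max_def)
  show "t_ideal D J \<Longrightarrow> J \<subseteq> D \<Longrightarrow> 1 \<notin> J \<Longrightarrow> M \<subseteq> J \<Longrightarrow> J = M"
    using assms one_mem unfolding t_Max_def psubset_eq by (metis (mono_tags, lifting) mem_Collect_eq)
qed

text \<open>The ideals none of whose finite subsets has \<open>1\<close> in its \<open>v\<close>-closure form an inductive
  family, and its maximal members are the \<open>t\<close>-maximal ideals.\<close>

lemma ex_t_max_nonzero:
  assumes C: "submodule_of D C" "C \<subseteq> D" "C \<noteq> {0}"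
    and no: "\<And>F. finite F \<Longrightarrow> F \<subseteq> C \<Longrightarrow> 1 \<notin> v_closure D F"
  shows "\<exists>M\<in>t_Max D. C \<subseteq> M"
proof -
  define A where "A = {I. submodule_of D I \<and> I \<subseteq> D \<and> C \<subseteq> I \<and>
    (\<forall>F. finite F \<longrightarrow> F \<subseteq> I \<longrightarrow> 1 \<notin> v_closure D F)}"
  have "\<exists>M\<in>A. \<forall>X\<in>A. M \<subseteq> X \<longrightarrow> X = M"
  proof (rule subset_Zorn_nonempty)
    show "A \<noteq> {}" using assms by (auto simp: A_def)
    fix \<C> assume ch: "\<C> \<noteq> {}" "subset.chain A \<C>"
    have sub: "X \<in> A" if "X \<in> \<C>" for X using ch(2) that by (auto simp: subset.chain_def)
    have pair: "\<exists>X\<in>\<C>. x \<in> X \<and> y \<in> X" if xy: "x \<in> \<Union>\<C>" "y \<in> \<Union>\<C>" for x y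
    proof -
      obtain X Y where XY: "X \<in> \<C>" "Y \<in> \<C>" "x \<in> X" "y \<in> Y" using xy by auto
      then have "X \<subseteq> Y \<or> Y \<subseteq> X" using ch(2) unfolding subset.chain_def by blast
      with XY show ?thesis by blast
    qed
    have subm: "submodule_of D X" if "X \<in> \<C>" for X using sub[OF that] by (simp add: A_def)
    have "submodule_of D (\<Union>\<C>)"
      unfolding submodule_iff
    proof (intro conjI ballI)
      show "0 \<in> \<Union>\<C>" using ch(1) subm submoduleD(1) by blast
      show "x + y \<in> \<Union>\<C>" if "x \<in> \<Union>\<C>" "y \<in> \<Union>\<C>" for x y
        using pair[OF that] submoduleD(2)[OF subm] by blast
      show "d * x \<in> \<Union>\<C>" if "d \<in> D" "x \<in> \<Union>\<C>" for d x
        using that submoduleD(3)[OF subm] by blast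
    qed
    moreover have "1 \<notin> v_closure D F" if F: "finite F" "F \<subseteq> \<Union>\<C>" for F
    proof -
      have "\<exists>X\<in>\<C>. F \<subseteq> X" using finite_subset_Union_chain[OF F ch(1)] ch(2) by blast
      with sub F(1) show ?thesis by (auto simp: A_def)
    qed
    ultimately show "\<Union>\<C> \<in> A" using ch(1) sub unfolding A_def by blast
  qed
  then obtain M where M: "M \<in> A" "\<And>X. X \<in> A \<Longrightarrow> M \<subseteq> X \<Longrightarrow> X = M" by blast
  have M': "submodule_of D M" "M \<subseteq> D" "C \<subseteq> M" "\<And>F. finite F \<Longrightarrow> F \<subseteq> M \<Longrightarrow> 1 \<notin> v_closure D F"
    using M(1) by (auto simp: A_def)
  have M0: "M \<noteq> {0}" using M'(3) C submoduleD(1)[OF C(1)] by blast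
  have nM: "nonzero_fractional_ideal D M"
    using M' M0 by (simp add: nonzero_fractional_ideal_def fractional_integral)
  \<comment> \<open>The family is stable under t-closure, since a finite subset of the closure lies
    in the v-closure of a finite subset of M; maximality then makes M a t-ideal.\<close>
  have "t_closure D M \<in> A"
  proof -
    have "1 \<notin> v_closure D F" if "finite F" "F \<subseteq> t_closure D M" for F
      using finite_subset_t_closure[OF nM that] M'(4) v_closure_trans by blast
    moreover have "t_closure D M \<subseteq> D"
    proof
      fix x assume "x \<in> t_closure D M"
      then obtain F where "F \<subseteq> M" "x \<in> v_closure D F" by (auto simp: t_closure_iff[OF nM])
      with M'(2) v_closure_subset_D[of F] show "x \<in> D" by blast
    qed
    ultimately show ?thesis
      using subset_t_closure[OF nM] M'(3) submodule_t_closure[OF nM] by (auto simp: A_def)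
  qed
  with M(2) subset_t_closure[OF nM] nM have tM: "t_ideal D M" by (simp add: t_ideal_def)
  have 1: "1 \<notin> M" using M'(4)[of "{1}"] subset_v_closure by blast
  have "J = M" if J: "t_ideal D J" "J \<subset> D" "M \<subseteq> J" for J
  proof (rule M(2)[OF _ J(3)])
    have "1 \<notin> J" using J(2) submoduleD(4)[OF t_idealD(1)[OF J(1)], of _ 1] by auto
    with J M'(3) t_idealD[OF J(1)] show "J \<in> A" unfolding A_def by blast
  qed
  with tM M' 1 one_mem have "M \<in> t_Max D" unfolding t_Max_def by blast
  with M'(3) show ?thesis by blast
qed

text \<open>An element a / b outside D has a nonunit denominator b, and the principal t-ideal b D is
  then proper.\<close>

lemma t_Max_nonempty: "t_Max D \<noteq> {}"
proof -
  obtain x where x: "x \<notin> D" using proper by blast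
  obtain a b where ab: "a \<in> D" "b \<in> D" "b \<noteq> 0" "x = a / b" using quotient by blast
  have t: "t_ideal D ((*) b ` D)" using ab t_ideal_principal by blast
  have "1 \<notin> (*) b ` D"
  proof
    assume "1 \<in> (*) b ` D"
    then obtain c where "c \<in> D" "b * c = 1" by force
    moreover from this have "c = inverse b" by (metis inverse_unique)
    ultimately have "x = a * c" using ab by (simp add: divide_inverse)
    with x ab \<open>c \<in> D\<close> mult_mem[of a c] show False by simp
  qed
  then have "\<exists>M\<in>t_Max D. (*) b ` D \<subseteq> M"
  proof (intro ex_t_max_nonzero)
    show "submodule_of D ((*) b ` D)" "(*) b ` D \<noteq> {0}" using t_idealD[OF t] by auto
    show "(*) b ` D \<subseteq> D" using ab mult_mem by blast
    show "1 \<notin> v_closure D F" if "finite F" "F \<subseteq> (*) b ` D" for F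
      using t_idealD(3)[OF t that] \<open>1 \<notin> (*) b ` D\<close> by blast
  qed
  then show ?thesis by blast
qed

text \<open>The zero ideal lies in every t-maximal ideal, and one exists. The contrapositive is the
  source of finite sets F with 1 in their v-closure.\<close>

lemma ex_t_max:
  assumes C: "submodule_of D C" "C \<subseteq> D"
    and no: "\<And>F. finite F \<Longrightarrow> F \<subseteq> C \<Longrightarrow> 1 \<notin> v_closure D F"
  shows "\<exists>M\<in>t_Max D. C \<subseteq> M"
proof (cases "C = {0}")
  case True
  then show ?thesis using t_Max_nonempty t_maxD(2) submoduleD(1) by blast
qed (use assms ex_t_max_nonzero in blast)

lemma t_max_not_v: "M \<in> t_Max D \<Longrightarrow> finite F \<Longrightarrow> F \<subseteq> M \<Longrightarrow> 1 \<notin> v_closure D F"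
  using t_idealD(3)[OF t_maxD(1)] t_maxD(5) by blast

text \<open>If a * b is in M but a is not, then M + a D lies in no t-maximal ideal, so it has a
  finite subset F with 1 in its v-closure. Then b F is contained in M, and b = b * 1 lies in its
  v-closure, hence in M.\<close>

lemma prime_t_max:
  assumes M: "M \<in> t_Max D"
  shows "prime_of M"
  unfolding primeideal_iff
proof (intro conjI ballI impI t_maxD[OF M])
  fix a b assume ab: "a \<in> D" "b \<in> D" "a * b \<in> M"
  note sM = t_maxD(2)[OF M]
  show "a \<in> M \<or> b \<in> M"
  proof (rule ccontr)
    assume "\<not> (a \<in> M \<or> b \<in> M)"
    then have a: "a \<notin> M" "b \<notin> M" by auto
    let ?C = "{m + a * d |m d. m \<in> M \<and> d \<in> D}"
    have C: "submodule_of D ?C" unfolding submodule_iff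
    proof (intro conjI ballI)
      show "0 \<in> ?C" using submoduleD(1)[OF sM] by force
    next
      fix x y assume "x \<in> ?C" "y \<in> ?C"
      then obtain m d n e where "x = m + a * d" "y = n + a * e" "m \<in> M" "n \<in> M" "d \<in> D" "e \<in> D"
        by blast
      moreover from this have "x + y = (m + n) + a * (d + e)" by (simp add: algebra_simps)
      ultimately show "x + y \<in> ?C" using submoduleD(2)[OF sM] add_mem by blast
    next
      fix x y assume "y \<in> D" "x \<in> ?C"
      then obtain m d where "y \<in> D" "x = m + a * d" "m \<in> M" "d \<in> D"
        by blast
      moreover from this have "y * x = y * m + a * (y * d)" by (simp add: algebra_simps)
      ultimately show "y * x \<in> ?C" using submoduleD(3)[OF sM] mult_mem by blast
    qed
    have sub: "?C \<subseteq> D" using t_maxD(4)[OF M] ab add_mem mult_mem by auto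
    have "M \<subseteq> ?C"
    proof
      fix m assume "m \<in> M"
      moreover have "m = m + a * 0" by simp
      ultimately show "m \<in> ?C" using zero_mem by blast
    qed
    have "a \<in> ?C" using submoduleD(1)[OF sM] by (intro CollectI exI[of _ 0] exI[of _ 1]) simp
    have "\<not> (\<exists>N\<in>t_Max D. ?C \<subseteq> N)"
    proof
      assume "\<exists>N\<in>t_Max D. ?C \<subseteq> N"
      then obtain N where N: "N \<in> t_Max D" "?C \<subseteq> N" by blast
      then have "N = M" using t_maxD(6)[OF M t_maxD(1)[OF N(1)] t_maxD(4,5)[OF N(1)]] \<open>M \<subseteq> ?C\<close> by blast
      with N \<open>a \<in> ?C\<close> a show False by blast
    qed
    then obtain F where F: "finite F" "F \<subseteq> ?C" "1 \<in> v_closure D F"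
      using ex_t_max[OF C sub] by blast
    have "(*) b ` F \<subseteq> M"
    proof
      fix y assume "y \<in> (*) b ` F"
      then obtain m d where md: "m \<in> M" "d \<in> D" "y = b * (m + a * d)" using F(2) by blast
      then have "y = b * m + d * (a * b)" by (simp add: algebra_simps)
      then show "y \<in> M" using md ab submoduleD[OF sM] by simp
    qed
    moreover have "b * 1 \<in> v_closure D ((*) b ` F)" using F(3) by (rule v_closure_scale)
    ultimately show False using t_idealD(3)[OF t_maxD(1)[OF M], of "(*) b ` F"] F(1) a(2) by auto
  qed
qed

section \<open>Local membership at all t-maximal ideals, and w-ideals\<close>

lemma locally_in:
  assumes I: "submodule_of D I" and x: "\<And>M. M \<in> t_Max D \<Longrightarrow> \<exists>s\<in>D - M. s * x \<in> I"
  obtains F where "finite F" "F \<subseteq> D" "1 \<in> v_closure D F" "\<And>f. f \<in> F \<Longrightarrow> f * x \<in> I"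
proof -
  \<comment> \<open>The multipliers that bring x into I form an ideal of D that is contained in no
    t-maximal ideal.\<close>
  let ?C = "{s\<in>D. s * x \<in> I}"
  have "submodule_of D ?C"
    using submoduleD[OF I] by (auto simp: submodule_iff ring_distribs mult.assoc add_mem mult_mem)
  then show thesis using ex_t_max[of ?C] x that by blast
qed

text \<open>Multiplying 1 in F_v by x puts x into the v-closure of x F, a finite subset of I. For a
  nonzero fractional ideal this says that I_w is contained in I_t.\<close>

lemma locally_in_v_closure:
  assumes "submodule_of D I" "\<And>M. M \<in> t_Max D \<Longrightarrow> \<exists>s\<in>D - M. s * x \<in> I"
  shows "\<exists>F. finite F \<and> F \<subseteq> I \<and> x \<in> v_closure D F"
proof -
  obtain F where F: "finite F" "F \<subseteq> D" "1 \<in> v_closure D F" "\<And>f. f \<in> F \<Longrightarrow> f * x \<in> I"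
    using locally_in[OF assms] by metis
  then show ?thesis
    using v_closure_scale[OF F(3), of x]
    by (intro exI[of _ "(*) x ` F"]) (auto simp: mult.commute)
qed

text \<open>The nontrivial inclusion in the representation of D as the intersection of the D_M over
  the t-maximal M; it makes membership in D a local question.\<close>

lemma locally_in_D:
  assumes "\<And>M. M \<in> t_Max D \<Longrightarrow> \<exists>s\<in>D - M. s * x \<in> D"
  shows "x \<in> D"
  using locally_in_v_closure[of D x] assms v_closure_subset_D
  by (auto simp: submodule_iff add_mem mult_mem)

lemma w_closure_iff:
  "submodule_of D I \<Longrightarrow> x \<in> w_closure D I \<longleftrightarrow> (\<forall>M\<in>t_Max D. \<exists>s\<in>D - M. s * x \<in> I)"
  by (auto simp: w_closure_def frac_prod_localize[OF prime_t_max])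

lemma subset_w_closure: "submodule_of D I \<Longrightarrow> I \<subseteq> w_closure D I"
  using t_maxD(5) by (auto simp: w_closure_iff intro!: bexI[of _ 1])

lemma w_idealI:
  assumes "submodule_of D I" "I \<noteq> {0}" "d \<in> D" "d \<noteq> 0" "\<And>x. x \<in> I \<Longrightarrow> d * x \<in> D"
    and "\<And>x. (\<And>M. M \<in> t_Max D \<Longrightarrow> \<exists>s\<in>D - M. s * x \<in> I) \<Longrightarrow> x \<in> I"
  shows "w_ideal D I"
proof -
  have "w_closure D I \<subseteq> I" using assms(6) by (auto simp: w_closure_iff[OF assms(1)])
  then have "w_closure D I = I" using subset_w_closure[OF assms(1)] by blast
  moreover have "fractional_ideal D I" using assms(1,3-5) by (auto simp: fractional_ideal_def)
  ultimately show ?thesis using assms(2) by (simp add: w_ideal_def nonzero_fractional_ideal_def)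
qed

lemma w_idealD:
  assumes "w_ideal D I"
  shows "submodule_of D I" "I \<noteq> {0}" "\<exists>d\<in>D. d \<noteq> 0 \<and> (\<forall>x\<in>I. d * x \<in> D)"
    and "(\<And>M. M \<in> t_Max D \<Longrightarrow> \<exists>s\<in>D - M. s * x \<in> I) \<Longrightarrow> x \<in> I"
proof -
  show I: "submodule_of D I" "I \<noteq> {0}" "\<exists>d\<in>D. d \<noteq> 0 \<and> (\<forall>x\<in>I. d * x \<in> D)"
    using assms by (auto simp: w_ideal_def nonzero_fractional_ideal_def fractional_ideal_def)
  show "(\<And>M. M \<in> t_Max D \<Longrightarrow> \<exists>s\<in>D - M. s * x \<in> I) \<Longrightarrow> x \<in> I"
    using w_closure_iff[OF I(1), of x] assms by (simp add: w_ideal_def)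
qed

lemma not_field: "\<not> field (ring_on D)"
proof
  assume "field (ring_on D)"
  then interpret field "ring_on D" .
  have "x \<in> D" for x
  proof -
    obtain a b where ab: "a \<in> D" "b \<in> D" "b \<noteq> 0" "x = a / b" using quotient by blast
    then have "b \<in> Units (ring_on D)" using field_Units by simp
    then obtain c where "c \<in> D" "b * c = 1" by (auto simp: Units_def)
    moreover from this have "c = inverse b" by (metis inverse_unique)
    ultimately have "x = a * c" using ab by (simp add: divide_inverse)
    with ab(1) \<open>c \<in> D\<close> mult_mem show ?thesis by (metis (no_types))
  qed
  with proper show False by blast
qed

lemma w_divisorial_iff: "w_divisorial D \<longleftrightarrow> (\<forall>I. w_ideal D I \<longrightarrow> v_closure D I \<subseteq> I)"
proof -
  have "divisorial_ideal D I \<longleftrightarrow> v_closure D I \<subseteq> I" if "w_ideal D I" for I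
    using that subset_v_closure[of I] by (auto simp: divisorial_ideal_def w_ideal_def)
  then show ?thesis using not_field by (auto simp: w_divisorial_def)
qed


section \<open>Localizations that are valuation domains\<close>

text \<open>For a nonzero prime \<open>P\<close> this says that \<open>D\<^sub>P\<close> is a valuation domain, with
  denominators cleared.\<close>

definition val_at :: "'a set \<Rightarrow> bool" where
  "val_at P \<longleftrightarrow> (\<forall>x y. \<exists>u\<in>D - P. \<exists>r\<in>D. u * x = r * y \<or> u * y = r * x)"

lemma val_atE:
  assumes "val_at P"
  obtains u r where "u \<in> D - P" "r \<in> D" "u * x = r * y" | u r where "u \<in> D - P" "r \<in> D" "u * y = r * x"
  using assms unfolding val_at_def by metis

lemma val_at_mono: "val_at M \<Longrightarrow> P \<subseteq> M \<Longrightarrow> val_at P"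
  unfolding val_at_def by (meson Diff_iff subsetD)

lemma val_at_iff:
  assumes P: "prime_of P" "P \<noteq> {0}"
  shows "valuation_domain (localize D P) \<longleftrightarrow> val_at P"
proof
  note iff = localize_iff[OF primeD(5)[OF P(1)]]
  have one: "1 \<in> D - P" using primeD(11)[OF P(1)] .
  {
    assume V: "valuation_domain (localize D P)"
    show "val_at P"
      unfolding val_at_def
    proof (intro allI)
      fix x y :: 'a
      show "\<exists>u\<in>D - P. \<exists>r\<in>D. u * x = r * y \<or> u * y = r * x"
      proof (cases "x = 0 \<or> y = 0")
        case True
        then show ?thesis using one by (intro bexI[of _ 1] bexI[of _ 0]) auto
      next
        case False
        then have "x / y \<in> localize D P \<or> inverse (x / y) \<in> localize D P"
          using V unfolding valuation_domain_def by (metis divide_eq_0_iff)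
        then obtain s where "s \<in> D - P" "s * (x / y) \<in> D \<or> s * (y / x) \<in> D"
          by (auto simp: iff)
        moreover have "s * x = (s * (x / y)) * y" "s * y = (s * (y / x)) * x" for s using False by auto
        ultimately show ?thesis by metis
      qed
    qed
  next
    assume V: "val_at P"
    interpret L: frac_dom "localize D P" using frac_dom_localize[OF P] .
    show "valuation_domain (localize D P)"
      unfolding valuation_domain_def
    proof (intro conjI allI impI L.domain_D)
      fix x :: 'a assume "x \<noteq> 0"
      show "x \<in> localize D P \<or> inverse x \<in> localize D P"
      proof (rule val_atE[OF V, of x 1])
        fix u r assume "u \<in> D - P" "r \<in> D" "u * 1 = r * x"
        moreover from this \<open>x \<noteq> 0\<close> have "u * inverse x = r" by (simp add: field_simps)
        ultimately show ?thesis by (metis iff)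
      next
        fix u r assume "u \<in> D - P" "r \<in> D" "u * x = r * 1"
        then show ?thesis by (metis iff mult.right_neutral)
      qed
    qed
  }
qed

lemma PvMD_iff: "PvMD D \<longleftrightarrow> (\<forall>M\<in>t_Max D. val_at M)"
  using val_at_iff[OF prime_t_max t_maxD(3)] by (simp add: PvMD_def)

text \<open>In a valuation domain finitely many elements are all multiples of one of them; the
  denominators met along the induction are collected in s.\<close>

lemma common_divisor:
  assumes P: "prime_of P" "val_at P" and "finite F" "F \<noteq> {}"
  shows "\<exists>j\<in>F. \<exists>s\<in>D - P. \<forall>f\<in>F. \<exists>r\<in>D. s * f = r * j"
  using assms(3,4)
proof (induction rule: finite_ne_induct)
  case (singleton x)
  show ?case using primeD(11)[OF P(1)] by (auto intro!: bexI[of _ 1])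
next
  case (insert x F)
  then obtain j s where j: "j \<in> F" "s \<in> D - P" "\<forall>f\<in>F. \<exists>r\<in>D. s * f = r * j" by blast
  show ?case
  proof (rule val_atE[OF P(2), of x j])
    fix u r assume u: "u \<in> D - P" "r \<in> D" "u * x = r * j"
    have "\<exists>t\<in>D. s * u * f = t * j" if f: "f \<in> insert x F" for f
    proof (cases "f = x")
      case True
      then have "s * u * f = (s * r) * j" using u by (simp add: mult.assoc)
      with u j mult_mem show ?thesis by blast
    next
      case False
      then obtain t where "t \<in> D" "s * f = t * j" using j(3) f by auto
      then have "s * u * f = (u * t) * j" by (metis mult.assoc mult.commute)
      with u \<open>t \<in> D\<close> mult_mem show ?thesis by blast
    qed
    with j primeD(10)[OF P(1) j(2) u(1)] show ?thesis by (intro bexI[of _ j] bexI[of _ "s * u"]) auto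
  next
    fix u r assume u: "u \<in> D - P" "r \<in> D" "u * j = r * x"
    have "\<exists>t\<in>D. s * u * f = t * x" if f: "f \<in> insert x F" for f
    proof (cases "f = x")
      case True
      with u j mult_mem show ?thesis by blast
    next
      case False
      then obtain t where "t \<in> D" "s * f = t * j" using j(3) f by auto
      then have "s * u * f = (t * r) * x" using u by (metis mult.assoc mult.commute)
      with u \<open>t \<in> D\<close> mult_mem show ?thesis by blast
    qed
    with primeD(10)[OF P(1) j(2) u(1)] show ?thesis by (intro bexI[of _ x] bexI[of _ "s * u"]) auto
  qed
qed

text \<open>In D_P the set F is generated by one j, so s F lies in j D for some s outside P.
  Principal ideals are divisorial, hence s F_v lies in j D as well: the v-closure of a finite set
  changes nothing locally.\<close>

lemma v_closure_local:
  assumes P: "prime_of P" "val_at P" and F: "finite F" "F \<subseteq> I" "x \<in> v_closure D F"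
    and I: "submodule_of D I"
  shows "\<exists>s\<in>D - P. s * x \<in> I"
proof -
  \<comment> \<open>\<open>common_divisor\<close> needs a nonempty set; the added 0 is harmless
    because it lies in I.\<close>
  have "finite (insert 0 F)" "insert 0 F \<noteq> {}" using F by auto
  from common_divisor[OF P this]
  obtain j s where j: "j \<in> insert 0 F" "s \<in> D - P" "\<forall>f\<in>F. \<exists>r\<in>D. s * f = r * j"
    by (metis insertI2)
  have "(*) s ` F \<subseteq> (*) j ` D"
  proof
    fix y assume "y \<in> (*) s ` F"
    then obtain r where "r \<in> D" "y = j * r" using j(3) by (auto simp: mult.commute)
    then show "y \<in> (*) j ` D" by blast
  qed
  then have "s * x \<in> (*) j ` D"
    using v_closure_subset_principal v_closure_scale[OF F(3), of s] by blast
  moreover have "j \<in> I" using j(1) F(2) submoduleD(1)[OF I] by auto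
  ultimately have "s * x \<in> I" using submoduleD(4)[OF I] by auto
  with j(2) show ?thesis by blast
qed

lemma t_ideal_prime_val:
  assumes P: "prime_of P" "P \<noteq> {0}" "val_at P"
  shows "t_ideal D P"
proof (rule t_idealI[OF primeD(1,2)[OF P(1)] P(2)])
  fix F x assume F: "finite F" "F \<subseteq> P" "x \<in> v_closure D F"
  then obtain s where "s \<in> D - P" "s * x \<in> P"
    using v_closure_local[OF P(1,3) F primeD(1)[OF P(1)]] by blast
  moreover have "x \<in> D" using v_closure_subset_D F primeD(2)[OF P(1)] by blast
  ultimately show "x \<in> P" using primeD(4)[OF P(1)] by blast
qed

text \<open>A prime inside a t-maximal ideal M inherits \<open>val_at\<close> from M and is
  therefore a t-ideal if nonzero, so t-primes are described without t-closures.\<close>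

lemma t_Spec_iff:
  assumes "PvMD D"
  shows "P \<in> t_Spec D \<longleftrightarrow> prime_of P \<and> P \<noteq> {0} \<and> (\<exists>M\<in>t_Max D. P \<subseteq> M)"
proof
  assume P: "P \<in> t_Spec D"
  then have P': "prime_of P" "t_ideal D P" by (auto simp: t_Spec_def)
  have "\<exists>M\<in>t_Max D. P \<subseteq> M"
    using t_idealD(3)[OF P'(2)] primeD(1-3)[OF P'(1)] by (intro ex_t_max) auto
  with P' t_idealD(2) show "prime_of P \<and> P \<noteq> {0} \<and> (\<exists>M\<in>t_Max D. P \<subseteq> M)" by blast
next
  assume "prime_of P \<and> P \<noteq> {0} \<and> (\<exists>M\<in>t_Max D. P \<subseteq> M)"
  with assms val_at_mono t_ideal_prime_val show "P \<in> t_Spec D"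
    unfolding t_Spec_def PvMD_iff by blast
qed

lemma t_Max_subset_t_Spec: "t_Max D \<subseteq> t_Spec D"
  using prime_t_max t_maxD(1) by (auto simp: t_Spec_def)

lemma t_max_eqI: "M \<in> t_Max D \<Longrightarrow> N \<in> t_Max D \<Longrightarrow> M \<subseteq> N \<Longrightarrow> M = N"
  using t_maxD(6)[of M N] t_maxD(1,4,5)[of N] by blast

lemma ex_unique_t_max:
  "PvMD D \<Longrightarrow> t_primes_in_unique_t_maximal D \<Longrightarrow> prime_of P \<Longrightarrow> P \<noteq> {0} \<Longrightarrow>
    M \<in> t_Max D \<Longrightarrow> N \<in> t_Max D \<Longrightarrow> P \<subseteq> M \<Longrightarrow> P \<subseteq> N \<Longrightarrow> M = N"
  unfolding t_primes_in_unique_t_maximal_def using t_Spec_iff by metis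

text \<open>In the valuation domain D_N the element s must divide p: if instead p divided s, then u
  * s would be in P for some u outside N, although neither factor is.\<close>

lemma divide_prime:
  assumes "prime_of P" "prime_of N" "P \<subseteq> N" "val_at N" "p \<in> P" "s \<in> D - P"
  shows "\<exists>w\<in>D - N. \<exists>r\<in>D. w * p = r * s"
proof (rule val_atE[OF assms(4), of p s])
  fix u r assume u: "u \<in> D - N" "r \<in> D" "u * s = r * p"
  then have "u * s \<in> P" using primeD(7)[OF assms(1)] assms(5) by simp
  then show ?thesis using primeD(4)[OF assms(1), of u s] u assms(3,6) by blast
qed blast

text \<open>When \<open>D\<^sub>M\<close> is a valuation domain, this is the largest prime ideal in
  \<open>M \<inter> N\<close>.\<close>

definition common_prime :: "'a set \<Rightarrow> 'a set \<Rightarrow> 'a set" where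
  "common_prime M N = {a\<in>D. \<forall>r\<in>D. \<forall>u\<in>D - M. \<forall>v\<in>D - N. a * r \<noteq> u * v}"

lemma common_prime_subset:
  assumes "prime_of M" "prime_of N"
  shows "common_prime M N \<subseteq> M" "common_prime M N \<subseteq> N"
proof -
  have "a \<notin> common_prime M N" if "a \<in> D - M \<or> a \<in> D - N" for a
  proof -
    have "a * 1 = a * 1" "a * 1 = 1 * a" by simp_all
    with that primeD(11)[OF assms(1)] primeD(11)[OF assms(2)] show ?thesis
      unfolding common_prime_def using one_mem by blast
  qed
  then show "common_prime M N \<subseteq> M" "common_prime M N \<subseteq> N" by (auto simp: common_prime_def)
qed

text \<open>The complement in D is the saturation of the multiplicative set of products of elements
  outside M with elements outside N, which settles multiples and primeness. Closure under addition
  comes from \<open>val_at M\<close>: if a is a local multiple of b, so is a + b.\<close>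

lemma prime_common_prime:
  assumes M: "prime_of M" "val_at M" and N: "prime_of N"
  shows "prime_of (common_prime M N)"
  unfolding primeideal_iff submodule_iff
proof (intro conjI ballI impI)
  let ?P = "common_prime M N"
  show "0 \<in> ?P"
    using primeD(12)[OF M(1)] primeD(12)[OF N] by (auto simp: common_prime_def)
  show "1 \<notin> ?P" using common_prime_subset[OF M(1) N] primeD(3)[OF N] by blast
  show "?P \<subseteq> D" by (auto simp: common_prime_def)
  show "d * a \<in> ?P" if "d \<in> D" "a \<in> ?P" for d a
  proof -
    have "d * a * r \<noteq> u * v" if "r \<in> D" "u \<in> D - M" "v \<in> D - N" for r u v
    proof -
      have "a * (d * r) \<noteq> u * v"
        using that \<open>a \<in> ?P\<close> mult_mem[OF \<open>d \<in> D\<close> that(1)] unfolding common_prime_def by blast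
      then show ?thesis by (simp add: mult_ac)
    qed
    with that mult_mem show ?thesis by (auto simp: common_prime_def)
  qed
  show "a \<in> ?P \<or> b \<in> ?P" if ab: "a \<in> D" "b \<in> D" "a * b \<in> ?P" for a b
  proof (rule ccontr)
    assume "\<not> (a \<in> ?P \<or> b \<in> ?P)"
    then obtain r u v r' u' v' where
      r: "r \<in> D" "u \<in> D - M" "v \<in> D - N" "a * r = u * v" "r' \<in> D" "u' \<in> D - M" "v' \<in> D - N" "b * r' = u' * v'"
      using ab unfolding common_prime_def by blast
    have "(a * b) * (r * r') = (a * r) * (b * r')" by (simp add: mult_ac)
    also have "\<dots> = (u * u') * (v * v')" unfolding r by (simp add: mult_ac)
    finally show False
      using ab(3) primeD(10)[OF M(1) r(2,6)] primeD(10)[OF N r(3,7)] mult_mem[OF r(1,5)]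
      unfolding common_prime_def by blast
  qed
  have sum: "a + b \<in> ?P" if ab: "a \<in> ?P" "b \<in> ?P" and u: "u \<in> D - M" "r \<in> D" "u * a = r * b" for a b u r
  proof -
    have abD: "a \<in> D" "b \<in> D" using ab by (auto simp: common_prime_def)
    have "(a + b) * c \<noteq> u' * v" if "c \<in> D" "u' \<in> D - M" "v \<in> D - N" for c u' v
    proof
      assume eq: "(a + b) * c = u' * v"
      have "b * ((r + u) * c) = (u * a + u * b) * c" unfolding u(3) by (simp add: algebra_simps)
      also have "\<dots> = u * ((a + b) * c)" by (simp add: algebra_simps)
      also have "\<dots> = (u * u') * v" unfolding eq by (simp add: mult.assoc)
      finally show False
        using ab(2) primeD(10)[OF M(1) u(1) that(2)] that mult_mem[OF add_mem[of r u] that(1)] u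
        unfolding common_prime_def by blast
    qed
    with abD add_mem show ?thesis by (auto simp: common_prime_def)
  qed
  show "a + b \<in> ?P" if "a \<in> ?P" "b \<in> ?P" for a b
    by (rule val_atE[OF M(2), of a b]) (use sum[of a b] sum[of b a] that in \<open>auto simp: add.commute\<close>)
qed

section \<open>\<open>w\<close>-divisoriality implies weakly Matlis\<close>

text \<open>This is \<open>p D\<^sub>M \<inter> D\<close>.\<close>

definition contraction :: "'a \<Rightarrow> 'a set \<Rightarrow> 'a set" where
  "contraction p M = {y\<in>D. \<exists>s\<in>D - M. \<exists>d\<in>D. s * y = p * d}"

lemma submodule_contraction:
  assumes M: "prime_of M"
  shows "submodule_of D (contraction p M)"
  unfolding submodule_iff
proof (intro conjI ballI)
  have "1 * 0 = p * 0" by simp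
  then show "0 \<in> contraction p M" unfolding contraction_def using primeD(11)[OF M] zero_mem by blast
  fix x assume "x \<in> contraction p M"
  then obtain s d where s: "x \<in> D" "s \<in> D - M" "d \<in> D" "s * x = p * d" by (auto simp: contraction_def)
  { fix y assume "y \<in> contraction p M"
    then obtain t e where t: "y \<in> D" "t \<in> D - M" "e \<in> D" "t * y = p * e" by (auto simp: contraction_def)
    have "(s * t) * (x + y) = t * (s * x) + s * (t * y)" by (simp add: algebra_simps)
    also have "\<dots> = p * (t * d + s * e)" unfolding s t by (simp add: algebra_simps)
    finally show "x + y \<in> contraction p M"
      using primeD(10)[OF M s(2) t(2)] s t add_mem mult_mem unfolding contraction_def by blast }
  { fix c assume "c \<in> D"
    moreover have "s * (c * x) = p * (c * d)" using s by (metis mult.left_commute)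
    ultimately show "c * x \<in> contraction p M" using s mult_mem unfolding contraction_def by blast }
qed

lemma mem_contraction_self:
  assumes "prime_of M" "p \<in> D"
  shows "p \<in> contraction p M"
proof -
  have "1 \<in> D - M" "1 * p = p * 1" using primeD(11)[OF assms(1)] by auto
  with assms(2) show ?thesis unfolding contraction_def using one_mem by blast
qed

text \<open>Elements that are locally in the set lie in D by \<open>locally_in_D\<close>, and the
  divisibility by p is read off at M alone.\<close>

lemma w_ideal_contraction:
  assumes M: "M \<in> t_Max D" and p: "p \<in> D" "p \<noteq> 0"
  shows "w_ideal D (contraction p M)"
proof (rule w_idealI[of _ 1])
  show "submodule_of D (contraction p M)" using submodule_contraction prime_t_max M by blast
  show "contraction p M \<noteq> {0}" using mem_contraction_self[OF prime_t_max[OF M] p(1)] p(2) by auto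
  fix y assume y: "\<And>M'. M' \<in> t_Max D \<Longrightarrow> \<exists>s\<in>D - M'. s * y \<in> contraction p M"
  then have "y \<in> D" by (intro locally_in_D) (auto simp: contraction_def)
  obtain s s' d where s: "s \<in> D - M" "s' \<in> D - M" "d \<in> D" "s' * (s * y) = p * d"
    using y[OF M] by (auto simp: contraction_def)
  then show "y \<in> contraction p M"
    using primeD(10)[OF prime_t_max[OF M] s(2,1)] \<open>y \<in> D\<close>
    unfolding contraction_def mult.assoc[symmetric] by blast
qed (auto simp: contraction_def)

text \<open>If \<open>P\<close> is the largest prime in \<open>M \<inter> N\<close> and \<open>p \<in> P\<close>, then
  \<open>J = p D\<^sub>M \<inter> D\<close> is a \<open>w\<close>-ideal, but \<open>J\<^sub>v\<close> contains \<open>p D\<^sub>P \<inter> D\<close>,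
  which is strictly larger when \<open>P \<noteq> M\<close>.\<close>

theorem w_divisorial_imp_unique_t_max:
  assumes pv: "PvMD D" and wd: "w_divisorial D"
  shows "t_primes_in_unique_t_maximal D"
  unfolding t_primes_in_unique_t_maximal_def
proof
  fix Q assume "Q \<in> t_Spec D"
  then have Q: "prime_of Q" "Q \<noteq> {0}" "\<exists>M\<in>t_Max D. Q \<subseteq> M" using t_Spec_iff[OF pv] by auto
  have "M = N" if MN: "M \<in> t_Max D" "N \<in> t_Max D" "Q \<subseteq> M" "Q \<subseteq> N" for M N
  proof (rule ccontr)
    assume "M \<noteq> N"
    note pM = prime_t_max[OF MN(1)] and pN = prime_t_max[OF MN(2)]
    have val: "val_at M'" if "M' \<in> t_Max D" for M' using pv that by (simp add: PvMD_iff)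
    define P where "P = common_prime M N"
    have P: "prime_of P" unfolding P_def using prime_common_prime pM pN val MN by blast
    have sub: "P \<subseteq> M" "P \<subseteq> N" unfolding P_def using common_prime_subset pM pN by blast+
    have "Q \<subseteq> P"
    proof
      fix q assume q: "q \<in> Q"
      have "q * r \<noteq> u * v" if "r \<in> D" "u \<in> D - M" "v \<in> D - N" for r u v
      proof
        assume "q * r = u * v"
        then have "u * v \<in> Q" using primeD(8)[OF Q(1)] q that by metis
        then show False using primeD(4)[OF Q(1)] that MN by blast
      qed
      then show "q \<in> P" unfolding P_def common_prime_def using primeD(9)[OF Q(1) q] by blast
    qed
    then obtain p where p: "p \<in> P" "p \<noteq> 0" using Q(2) primeD(5)[OF Q(1)] by blast
    then have pD: "p \<in> D" using primeD(9)[OF P] by blast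
    have "P \<noteq> M" "P \<noteq> N" using sub t_max_eqI MN \<open>M \<noteq> N\<close> by blast+
    then obtain m n where m: "m \<in> M" "m \<in> D - P" and n: "n \<in> N" "n \<in> D - P"
      using sub t_maxD(4) MN by blast
    let ?J = "contraction p M"
    have J: "v_closure D ?J \<subseteq> ?J"
      using wd w_ideal_contraction[OF MN(1) pD p(2)] w_divisorial_iff by blast
    \<comment> \<open>Every x in (D : J) carries p into P. Otherwise x * p * n is outside P, so it
      has a multiple u * v with u outside M and v outside N, and it divides p in D_N. Then v * r' is
      in J, and x * (v * r') * n = v * w is both inside and outside N.\<close>
    have mult_p: "x * p \<in> P" if x: "\<And>j. j \<in> ?J \<Longrightarrow> x * j \<in> D" for x
    proof (rule ccontr)
      assume xp: "x * p \<notin> P"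
      have "x * p \<in> D" using x mem_contraction_self[OF pM pD] .
      with xp have s: "x * p * n \<in> D - P" using primeD(10)[OF P] n by blast
      then obtain r u v where r: "r \<in> D" "u \<in> D - M" "v \<in> D - N" "x * p * n * r = u * v"
        unfolding P_def common_prime_def by auto
      obtain w r' where w: "w \<in> D - N" "r' \<in> D" "w * p = r' * (x * p * n)"
        using divide_prime[OF P pN sub(2) val[OF MN(2)] p(1) s] by blast
      have "u * (v * r') = (u * v) * r'" by (simp add: mult.assoc)
      also have "\<dots> = (w * p) * r" unfolding r(4)[symmetric] w(3) by (simp add: mult_ac)
      finally have "u * (v * r') = p * (w * r)" by (simp add: mult_ac)
      then have "v * r' \<in> ?J" using r w mult_mem unfolding contraction_def by blast
      then have "x * (v * r') \<in> D" by (rule x)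
      then have "x * (v * r') * n \<in> N" using primeD(7)[OF pN] n by blast
      moreover have "x * (v * r') * n = v * w"
      proof -
        have "p * (x * (v * r') * n) = v * (r' * (x * p * n))" by (simp add: mult_ac)
        also have "\<dots> = p * (v * w)" unfolding w(3)[symmetric] by (simp add: mult_ac)
        finally show ?thesis using p(2) by simp
      qed
      ultimately show False using primeD(10)[OF pN r(3) w(1)] by simp
    qed
    \<comment> \<open>Up to the unit u of D_M, y is p / m. Since m is in M, y lies outside p D_M,
      yet it turns out to lie in J_v.\<close>
    obtain u y where u: "u \<in> D - M" "y \<in> D" "u * p = y * m"
      using divide_prime[OF P pM sub(1) val[OF MN(1)] p(1) m(2)] by blast
    have m0: "m \<noteq> 0" using m primeD(5)[OF P] by blast
    have "y \<in> v_closure D ?J" unfolding v_closure_iff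
    proof (intro allI impI)
      fix x assume "\<forall>j\<in>?J. x * j \<in> D"
      then have x: "\<And>j. j \<in> ?J \<Longrightarrow> x * j \<in> D" by blast
      show "x * y \<in> D"
      proof (rule locally_in_D)
        fix M' assume M': "M' \<in> t_Max D"
        show "\<exists>s\<in>D - M'. s * (x * y) \<in> D"
        proof (cases "P \<subseteq> M'")
          case True
          \<comment> \<open>x * y equals u * (x * p) / m, and x * p, being in P, is divisible by m
            in the localization at M'.\<close>
          obtain w r' where w: "w \<in> D - M'" "r' \<in> D" "w * (x * p) = r' * m"
            using divide_prime[OF P prime_t_max[OF M'] True val[OF M'] mult_p[OF x] m(2)] by blast
          have "m * (w * (x * y)) = w * x * (y * m)" by (simp add: mult_ac)
          also have "\<dots> = u * (w * (x * p))" unfolding u(3)[symmetric] by (simp add: mult_ac)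
          also have "\<dots> = m * (u * r')" unfolding w(3) by (simp add: mult_ac)
          finally have "w * (x * y) = u * r'" using m0 by simp
          with w(1,2) u(1) mult_mem show ?thesis by (metis DiffD1)
        next
          case False
          \<comment> \<open>An element c of P outside M' is divisible by m in D_M, so c * y is in J
            and x * (c * y) is in D.\<close>
          then obtain c where c: "c \<in> P" "c \<in> D - M'" using primeD(2)[OF P] by blast
          obtain w r' where w: "w \<in> D - M" "r' \<in> D" "w * c = r' * m"
            using divide_prime[OF P pM sub(1) val[OF MN(1)] c(1) m(2)] by blast
          have "w * (c * y) = (w * c) * y" by (simp add: mult.assoc)
          also have "\<dots> = r' * (y * m)" unfolding w(3) by (simp add: mult_ac)
          also have "\<dots> = p * (u * r')" unfolding u(3)[symmetric] by (simp add: mult_ac)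
          finally have "c * y \<in> ?J" using w u c mult_mem unfolding contraction_def by blast
          from x[OF this] show ?thesis using c by (auto simp: mult.left_commute intro!: bexI[of _ c])
        qed
      qed
    qed
    with J obtain s d where s: "s \<in> D - M" "d \<in> D" "s * y = p * d" by (auto simp: contraction_def)
    have "p * (s * u) = s * (u * p)" by (simp add: mult_ac)
    also have "\<dots> = (s * y) * m" unfolding u(3) by (simp add: mult.assoc)
    also have "\<dots> = p * (d * m)" unfolding s(3) by (simp add: mult.assoc)
    finally have "s * u = d * m" using p(2) by simp
    then show False using primeD(10)[OF pM s(1) u(1)] primeD(7)[OF pM s(2) m(1)] by simp
  qed
  with Q(3) show "\<exists>!M. M \<in> t_Max D \<and> Q \<subseteq> M" by blast
qed


text \<open>\<open>common_prime M N\<close> lies in two t-maximal ideals, so it is zero. Hence the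
  nonzero b has a multiple u * v with u outside M and v outside N, and v is the element
  sought.\<close>

lemma ex_separating:
  assumes "PvMD D" "t_primes_in_unique_t_maximal D"
    and MN: "M \<in> t_Max D" "N \<in> t_Max D" "M \<noteq> N" and b: "b \<in> D" "b \<noteq> 0"
  shows "\<exists>c\<in>D - N. c \<in> contraction b M"
proof -
  note pM = prime_t_max[OF MN(1)] and pN = prime_t_max[OF MN(2)]
  have val: "val_at M" using assms by (simp add: PvMD_iff)
  have "b \<notin> common_prime M N"
    using ex_unique_t_max[OF assms(1,2) prime_common_prime[OF pM val pN] _ MN(1,2)]
      common_prime_subset[OF pM pN] MN(3) b(2) by blast
  then obtain r u v where r: "r \<in> D" "u \<in> D - M" "v \<in> D - N" "b * r = u * v"
    using b(1) unfolding common_prime_def by blast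
  then have "v \<in> contraction b M"
    unfolding contraction_def by (metis (mono_tags, lifting) DiffD1 mem_Collect_eq)
  with r show ?thesis by blast
qed

text \<open>Contrapositive of the fact that a prime containing a finite intersection of ideals
  contains one of them; the witnesses are multiplied. The submodules may be fractional, which also
  yields common denominators.\<close>

lemma ex_avoiding_prime:
  assumes N: "prime_of N" and "finite T" "\<And>M. M \<in> T \<Longrightarrow> submodule_of D (I M)"
    and "\<And>M. M \<in> T \<Longrightarrow> \<exists>c\<in>D - N. c \<in> I M"
  shows "\<exists>c\<in>D - N. \<forall>M\<in>T. c \<in> I M"
  using assms(2-4)
proof (induction T)
  case empty
  show ?case using primeD(11)[OF N] by blast
next
  case (insert M T)
  then obtain c d where c: "c \<in> D - N" "\<forall>M\<in>T. c \<in> I M" "d \<in> D - N" "d \<in> I M" by (metis insertI1 insertI2)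
  have "d * c \<in> I M'" if "M' \<in> insert M T" for M'
    using that c insert.prems(1) submoduleD(3,4) by (metis DiffD1 insertE)
  with primeD(10)[OF N c(3,1)] show ?case by blast
qed

text \<open>The ideals \<open>x D\<^sub>M \<inter> D\<close> with \<open>x \<in> M\<close> intersect in \<open>x D\<close>, so by duality
  \<open>1 / x\<close> is in the \<open>w\<close>-ideal \<open>A\<close> generated by their inverses. As \<open>A\<close> is of finite
  type, finitely many of them already intersect in \<open>x D\<close>.\<close>

theorem w_divisorial_imp_finite_character:
  assumes pv: "PvMD D" and wd: "w_divisorial D" and un: "t_primes_in_unique_t_maximal D"
    and x: "x \<in> D" "x \<noteq> 0"
  shows "finite {M \<in> t_Max D. x \<in> M}"
proof -
  define T where "T = {M \<in> t_Max D. x \<in> M}"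
  \<comment> \<open>\<open>kills S a\<close> means that a lies in (D : J), where J is the
    intersection of the ideals x D_M \<inter> D for M in S. Larger S allow more a, so A is a
    directed union.\<close>
  define kills where "kills S a \<longleftrightarrow> (\<forall>y\<in>D. (\<forall>M\<in>S. y \<in> contraction x M) \<longrightarrow> a * y \<in> D)" for S a
  define A where "A = {a. \<exists>S. finite S \<and> S \<subseteq> T \<and> kills S a}"
  have pr: "prime_of M" if "M \<in> T" for M using that prime_t_max by (simp add: T_def)
  have kills_mono: "kills S' a" if "kills S a" "S \<subseteq> S'" for S S' a
    using that unfolding kills_def by blast
  have xA: "a * x \<in> D" if "a \<in> A" for a
    using that mem_contraction_self[OF pr x(1)] x(1) unfolding A_def kills_def by blast
  have "0 \<in> A" "1 \<in> A" by (auto simp: A_def kills_def intro!: exI[of _ "{}"])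
  have sA: "submodule_of D A"
    unfolding submodule_iff
  proof (intro conjI ballI \<open>0 \<in> A\<close>)
    fix a b assume "a \<in> A" "b \<in> A"
    then obtain S S' where "finite S" "S \<subseteq> T" "kills S a" "finite S'" "S' \<subseteq> T" "kills S' b"
      by (auto simp: A_def)
    moreover from this have "kills (S \<union> S') (a + b)"
      using kills_mono[of S a "S \<union> S'"] kills_mono[of S' b "S \<union> S'"]
      by (auto simp: kills_def distrib_right add_mem)
    ultimately show "a + b \<in> A" unfolding A_def by blast
  next
    fix d a assume "d \<in> D" "a \<in> A"
    then show "d * a \<in> A" by (auto simp: A_def kills_def mult.assoc mult_mem)
  qed
  have "w_ideal D A"
  proof (rule w_idealI[OF sA _ x])
    show "A \<noteq> {0}" using \<open>1 \<in> A\<close> by auto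
    show "x * a \<in> D" if "a \<in> A" for a using xA[OF that] by (simp add: mult.commute)
    fix a assume "\<And>M. M \<in> t_Max D \<Longrightarrow> \<exists>s\<in>D - M. s * a \<in> A"
    from locally_in[OF sA this] obtain F where
      F: "finite F" "1 \<in> v_closure D F" "\<And>f. f \<in> F \<Longrightarrow> f * a \<in> A" by metis
    then have "\<forall>f\<in>F. \<exists>S. finite S \<and> S \<subseteq> T \<and> kills S (f * a)" by (auto simp: A_def)
    then obtain S where S: "\<forall>f\<in>F. finite (S f) \<and> S f \<subseteq> T \<and> kills (S f) (f * a)" by metis
    \<comment> \<open>The finitely many multiples f * a involve only finitely many t-maximal ideals;
      together these serve for a because 1 is in the v-closure of F.\<close>
    have "kills (\<Union>f\<in>F. S f) a"
      unfolding kills_def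
    proof (intro ballI impI)
      fix y assume y: "y \<in> D" "\<forall>M\<in>\<Union>f\<in>F. S f. y \<in> contraction x M"
      have "(a * y) * f \<in> D" if "f \<in> F" for f
      proof -
        have "f * a * y \<in> D" using S y that unfolding kills_def by blast
        then show ?thesis by (simp add: mult_ac)
      qed
      then have "(a * y) * 1 \<in> D" using F(2) unfolding v_closure_iff by blast
      then show "a * y \<in> D" by simp
    qed
    moreover have "finite (\<Union>f\<in>F. S f)" "(\<Union>f\<in>F. S f) \<subseteq> T" using F(1) S by auto
    ultimately show "a \<in> A" unfolding A_def by blast
  qed
  then have vA: "v_closure D A \<subseteq> A" using wd w_divisorial_iff by blast
  have "1 / x \<in> v_closure D A"
    unfolding v_closure_iff
  proof (intro allI impI)
    fix c assume c: "\<forall>a\<in>A. c * a \<in> D"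
    with \<open>1 \<in> A\<close> have "c \<in> D" by force
    show "c * (1 / x) \<in> D"
    proof (rule locally_in_D)
      fix M assume M: "M \<in> t_Max D"
      show "\<exists>s\<in>D - M. s * (c * (1 / x)) \<in> D"
      proof (cases "x \<in> M")
        case False
        with x \<open>c \<in> D\<close> show ?thesis by (intro bexI[of _ x]) auto
      next
        case True
        with M have "M \<in> T" by (simp add: T_def)
        \<comment> \<open>With J = x D_M \<inter> D, the module (D : J) is part of A; so c is in
          J_v, and J is divisorial.\<close>
        have "c \<in> v_closure D (contraction x M)"
          unfolding v_closure_iff
        proof (intro allI impI)
          fix a assume "\<forall>f\<in>contraction x M. a * f \<in> D"
          then have "kills {M} a" by (auto simp: kills_def)
          with \<open>M \<in> T\<close> have "a \<in> A" unfolding A_def by blast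
          with c show "a * c \<in> D" by (simp add: mult.commute)
        qed
        then have "c \<in> contraction x M"
          using wd w_ideal_contraction[OF M x] w_divisorial_iff by blast
        then obtain s d where "s \<in> D - M" "d \<in> D" "s * c = x * d" by (auto simp: contraction_def)
        with x show ?thesis by (intro bexI[of _ s]) simp_all
      qed
    qed
  qed
  with vA obtain S where S: "finite S" "S \<subseteq> T" "kills S (1 / x)" by (auto simp: A_def)
  have "T \<subseteq> S"
  proof
    fix N assume N: "N \<in> T"
    show "N \<in> S"
    proof (rule ccontr)
      assume "N \<notin> S"
      \<comment> \<open>Such a c satisfies c / x in D, which forces c = (c / x) * x into N.\<close>
      have "\<exists>c\<in>D - N. \<forall>M\<in>S. c \<in> contraction x M"
      proof (rule ex_avoiding_prime[OF pr[OF N] S(1)])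
        fix M assume M: "M \<in> S"
        then show "submodule_of D (contraction x M)" using submodule_contraction pr S(2) by blast
        show "\<exists>c\<in>D - N. c \<in> contraction x M"
          using M N S(2) \<open>N \<notin> S\<close> unfolding T_def by (intro ex_separating[OF pv un _ _ _ x]) auto
      qed
      then obtain c where c: "c \<in> D - N" "1 / x * c \<in> D" using S(3) unfolding kills_def by blast
      have "x \<in> N" using N by (simp add: T_def)
      then have "(1 / x * c) * x \<in> N" using primeD(7)[OF pr[OF N] c(2)] by blast
      with x c show False by simp
    qed
  qed
  with S(1) show ?thesis unfolding T_def[symmetric] by (rule finite_subset[rotated])
qed

lemma weakly_Matlis_if_w_divisorial: "PvMD D \<Longrightarrow> w_divisorial D \<Longrightarrow> weakly_Matlis D"
  using w_divisorial_imp_unique_t_max w_divisorial_imp_finite_character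
  by (simp add: weakly_Matlis_def)

section \<open>Principal localized primes\<close>

text \<open>That is, \<open>P D\<^sub>P\<close> is principal.\<close>

definition principal_at :: "'a set \<Rightarrow> bool" where
  "principal_at P \<longleftrightarrow> (\<exists>p\<in>P. \<forall>m\<in>P. \<exists>s\<in>D - P. \<exists>d\<in>D. s * m = p * d)"

lemma principal_atE:
  assumes "principal_at P" "prime_of P" "P \<noteq> {0}"
  obtains p where "p \<in> P" "p \<noteq> 0" "\<And>m. m \<in> P \<Longrightarrow> \<exists>s\<in>D - P. \<exists>d\<in>D. s * m = p * d"
proof -
  obtain p where p: "p \<in> P" "\<And>m. m \<in> P \<Longrightarrow> \<exists>s\<in>D - P. \<exists>d\<in>D. s * m = p * d"
    using assms(1) unfolding principal_at_def by blast
  have "p \<noteq> 0"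
  proof
    assume "p = 0"
    obtain m where m: "m \<in> P" "m \<noteq> 0" using assms(3) primeD(5)[OF assms(2)] by blast
    then obtain s where "s \<in> D - P" "s * m = 0" using p(2) \<open>p = 0\<close> by fastforce
    with m primeD(12)[OF assms(2)] show False by auto
  qed
  with p that show thesis by blast
qed

lemma frac_prod_least:
  assumes "\<And>x y. x \<in> Y \<Longrightarrow> y \<in> Y \<Longrightarrow> x + y \<in> Y" "\<And>a b. a \<in> I \<Longrightarrow> b \<in> J \<Longrightarrow> a * b \<in> Y"
  shows "frac_prod I J \<subseteq> Y"
proof
  fix x assume "x \<in> frac_prod I J"
  then show "x \<in> Y" by induction (use assms in auto)
qed

lemma frac_prod_mem: "a \<in> I \<Longrightarrow> b \<in> J \<Longrightarrow> a * b \<in> frac_prod I J"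
  using ideal_prod.prod[of a I b J "ring_on UNIV"] by simp

lemma submodule_frac_prod:
  assumes "submodule_of D I" "J \<noteq> {}"
  shows "submodule_of D (frac_prod I J)"
  unfolding submodule_iff
proof (intro conjI ballI)
  show "0 \<in> frac_prod I J"
    using frac_prod_mem[OF submoduleD(1)[OF assms(1)]] assms(2) by fastforce
  show "x + y \<in> frac_prod I J" if "x \<in> frac_prod I J" "y \<in> frac_prod I J" for x y
    using ideal_prod.sum[OF that] by simp
  fix d x assume d: "d \<in> D" and "x \<in> frac_prod I J"
  from this(2) show "d * x \<in> frac_prod I J"
  proof induction
    case (prod i j)
    then show ?case using frac_prod_mem[OF submoduleD(3)[OF assms(1) d]] by (simp add: mult.assoc)
  next
    case (sum x y)
    then show ?case using ideal_prod.sum[OF sum.IH] by (simp add: distrib_left)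
  qed
qed

lemma nonzero_fractional_square:
  assumes P: "prime_of P" "P \<noteq> {0}"
  shows "frac_prod P P \<subseteq> P" "nonzero_fractional_ideal D (frac_prod P P)"
proof -
  show sub: "frac_prod P P \<subseteq> P" using primeD(6,7,9)[OF P(1)] by (intro frac_prod_least) auto
  obtain p where "p \<in> P" "p \<noteq> 0" using P primeD(5) by blast
  then have "p * p \<in> frac_prod P P" "p * p \<noteq> 0" using frac_prod_mem by auto
  then show "nonzero_fractional_ideal D (frac_prod P P)"
    using fractional_integral[OF submodule_frac_prod[OF primeD(1)[OF P(1)]], of P]
      primeD(2,5)[OF P(1)] sub
    unfolding nonzero_fractional_ideal_def by auto
qed

text \<open>If P D_P is not principal and p is in P, some m in P is not in p D_P; then p is locally
  a multiple r * m with r in P, so it is locally in P^2 and thus in its t-closure. If p generates P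
  D_P, then P^2 is contained in p P D_P, which does not contain p, and v-closures of finite sets
  change nothing locally.\<close>

lemma t_square_neq_iff:
  assumes pv: "PvMD D" and P: "P \<in> t_Spec D"
  shows "t_closure D (frac_prod P P) \<noteq> P \<longleftrightarrow> principal_at P"
proof -
  from P obtain M where P': "prime_of P" "P \<noteq> {0}" "M \<in> t_Max D" "P \<subseteq> M" "t_ideal D P"
    using t_Spec_iff[OF pv] by (auto simp: t_Spec_def)
  note nz = nonzero_fractional_square[OF P'(1,2)]
  have val: "val_at P" using pv val_at_mono P'(3,4) by (auto simp: PvMD_iff)
  have sub: "t_closure D (frac_prod P P) \<subseteq> P"
  proof
    fix x assume "x \<in> t_closure D (frac_prod P P)"
    then obtain F where "finite F" "F \<subseteq> frac_prod P P" "x \<in> v_closure D F"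
      by (auto simp: t_closure_iff[OF nz(2)])
    with t_idealD(3)[OF P'(5), of F] nz(1) show "x \<in> P" by blast
  qed
  show ?thesis
  proof
    assume neq: "t_closure D (frac_prod P P) \<noteq> P"
    show "principal_at P"
    proof (rule ccontr)
      assume np: "\<not> principal_at P"
      have "p \<in> t_closure D (frac_prod P P)" if p: "p \<in> P" for p
      proof -
        have "\<exists>s\<in>D - M. s * p \<in> frac_prod P P" if M: "M \<in> t_Max D" for M
        proof (cases "P \<subseteq> M")
          case False
          then show ?thesis using frac_prod_mem p primeD(2)[OF P'(1)] by blast
        next
          case True
          obtain m where m: "m \<in> P" "\<And>s d. s \<in> D - P \<Longrightarrow> d \<in> D \<Longrightarrow> s * m \<noteq> p * d"
            using np p unfolding principal_at_def by blast
          have "val_at M" using pv M by (simp add: PvMD_iff)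
          then show ?thesis
          proof (rule val_atE[of M p m])
            fix u r assume u: "u \<in> D - M" "r \<in> D" "u * m = r * p"
            then have "u * m = p * r" by (simp add: mult.commute)
            with m(2)[of u r] u True show ?thesis by blast
          next
            fix u r assume u: "u \<in> D - M" "r \<in> D" "u * p = r * m"
            have "r \<in> P" using m(2)[of r u] u by (auto simp: mult.commute)
            with m(1) u frac_prod_mem show ?thesis by metis
          qed
        qed
        then show ?thesis
          using locally_in_v_closure[of "frac_prod P P" p] submodule_frac_prod[of P P]
            primeD(1,5)[OF P'(1)] by (auto simp: t_closure_iff[OF nz(2)])
      qed
      with neq sub show False by blast
    qed
  next
    assume "principal_at P"
    then obtain p where p: "p \<in> P" "p \<noteq> 0" "\<And>m. m \<in> P \<Longrightarrow> \<exists>s\<in>D - P. \<exists>d\<in>D. s * m = p * d"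
      using principal_atE P' by metis
    let ?Y = "{z. \<exists>s\<in>D - P. \<exists>d\<in>P. s * z = p * d}"
    have "frac_prod P P \<subseteq> ?Y"
    proof (rule frac_prod_least)
      fix a b assume ab: "a \<in> P" "b \<in> P"
      from p(3)[OF ab(1)] obtain s d where s: "s \<in> D - P" "d \<in> D" "s * a = p * d" by blast
      then have "s * (a * b) = p * (d * b)" by (simp add: mult.assoc[symmetric])
      with s primeD(7)[OF P'(1) s(2) ab(2)] show "a * b \<in> ?Y" by blast
    next
      fix x y assume "x \<in> ?Y" "y \<in> ?Y"
      then obtain s d t e where s: "s \<in> D - P" "d \<in> P" "s * x = p * d" "t \<in> D - P" "e \<in> P" "t * y = p * e"
        by blast
      have "(s * t) * (x + y) = t * (s * x) + s * (t * y)" by (simp add: algebra_simps)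
      also have "\<dots> = p * (t * d + s * e)" unfolding s by (simp add: algebra_simps)
      finally show "x + y \<in> ?Y"
        using primeD(10)[OF P'(1) s(1,4)] s primeD(6,7)[OF P'(1)] by blast
    qed
    moreover have "p \<notin> t_closure D (frac_prod P P)"
    proof
      assume "p \<in> t_closure D (frac_prod P P)"
      then obtain F where "finite F" "F \<subseteq> frac_prod P P" "p \<in> v_closure D F"
        by (auto simp: t_closure_iff[OF nz(2)])
      then obtain s where s: "s \<in> D - P" "s * p \<in> frac_prod P P"
        using v_closure_local[OF P'(1) val] submodule_frac_prod[of P P] primeD(1,5)[OF P'(1)] by blast
      with \<open>frac_prod P P \<subseteq> ?Y\<close> obtain t d where t: "t \<in> D - P" "d \<in> P" "t * (s * p) = p * d" by blast
      then have "p * (t * s) = p * d" by (simp add: mult_ac)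
      with p(2) t(2) primeD(10)[OF P'(1) t(1) s(1)] show False by simp
    qed
    ultimately show "t_closure D (frac_prod P P) \<noteq> P" using p(1) by blast
  qed
qed

lemma strongly_discrete_PvMD_iff:
  "strongly_discrete_PvMD D \<longleftrightarrow> PvMD D \<and> (\<forall>P\<in>t_Spec D. principal_at P)"
  using t_square_neq_iff by (auto simp: strongly_discrete_PvMD_def)

text \<open>If \<open>x \<notin> I D\<^sub>M\<close> then \<open>I \<subseteq> p x D\<^sub>M\<close>, where \<open>p\<close> generates
  \<open>M D\<^sub>M\<close>. A unit \<open>u\<close> of \<open>D\<^sub>M\<close> sufficiently divisible at the other
  \<open>t\<close>-maximal ideals gives \<open>u / (p x) \<in> (D : I)\<close>, which excludes \<open>x\<close> from
  \<open>I\<^sub>v\<close>.\<close>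

theorem w_divisorialI:
  assumes pv: "PvMD D" and pr: "\<And>M. M \<in> t_Max D \<Longrightarrow> principal_at M" and wm: "weakly_Matlis D"
  shows "w_divisorial D"
  unfolding w_divisorial_iff
proof (intro allI impI subsetI)
  fix I x assume I: "w_ideal D I" and x: "x \<in> v_closure D I"
  note sI = w_idealD(1)[OF I]
  show "x \<in> I"
  proof (rule ccontr)
    assume nx: "x \<notin> I"
    then obtain M where M: "M \<in> t_Max D" "\<And>s. s \<in> D - M \<Longrightarrow> s * x \<notin> I" using w_idealD(4)[OF I] by blast
    have x0: "x \<noteq> 0" using nx submoduleD(1)[OF sI] by blast
    note pM = prime_t_max[OF M(1)]
    have val: "val_at M" using pv M by (simp add: PvMD_iff)
    obtain p where p: "p \<in> M" "p \<noteq> 0" "\<And>m. m \<in> M \<Longrightarrow> \<exists>s\<in>D - M. \<exists>d\<in>D. s * m = p * d"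
      using principal_atE[OF pr[OF M(1)] pM t_maxD(3)[OF M(1)]] by metis
    \<comment> \<open>As x is not in i D_M, i is a multiple of x in D_M with a nonunit factor, which
      p divides.\<close>
    have Ix: "\<exists>s\<in>D - M. \<exists>d\<in>D. s * i = p * x * d" if i: "i \<in> I" for i
    proof (rule val_atE[OF val, of x i])
      fix u r assume "u \<in> D - M" "r \<in> D" "u * x = r * i"
      with M(2) submoduleD(3)[OF sI _ i] show ?thesis by metis
    next
      fix u r assume u: "u \<in> D - M" "r \<in> D" "u * i = r * x"
      have "r \<in> M" using M(2)[of r] u submoduleD(3)[OF sI _ i, of u] by auto
      then obtain s d where s: "s \<in> D - M" "d \<in> D" "s * r = p * d" using p(3) by blast
      have "(s * u) * i = (s * r) * x" using u by (simp add: mult.assoc)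
      also have "\<dots> = p * x * d" unfolding s(3) by (simp add: mult_ac)
      finally show ?thesis using primeD(10)[OF pM s(1) u(1)] s(2) by blast
    qed
    obtain d0 where d0: "d0 \<in> D" "d0 \<noteq> 0" "\<And>i. i \<in> I \<Longrightarrow> d0 * i \<in> D" using w_idealD(3)[OF I] by blast
    \<comment> \<open>A denominator e turns p * x * d0 into an element b of D, so that u / (p * x) *
      i = (u / b) * e * (d0 * i). Thus u only has to lie in b D_N, a condition at the finitely many
      N containing b.\<close>
    obtain b e where b: "b \<in> D" "e \<in> D" "e \<noteq> 0" "p * x * d0 = b / e" using quotient by blast
    have b0: "b \<noteq> 0" using b p(2) x0 d0(2) by auto
    have be: "b = p * x * d0 * e" using b by (simp add: field_simps)
    let ?T = "{N \<in> t_Max D. b \<in> N} - {M}"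
    have "finite ?T" using wm b b0 by (simp add: weakly_Matlis_def)
    have "\<exists>c\<in>D - M. \<forall>N\<in>?T. c \<in> contraction b N"
    proof (rule ex_avoiding_prime[OF pM \<open>finite ?T\<close>])
      fix N assume N: "N \<in> ?T"
      then show "submodule_of D (contraction b N)" using submodule_contraction prime_t_max by blast
      show "\<exists>c\<in>D - M. c \<in> contraction b N"
        using N M(1) wm by (intro ex_separating[OF pv _ _ _ _ b(1) b0]) (auto simp: weakly_Matlis_def)
    qed
    then obtain u where u: "u \<in> D - M" "\<And>N. N \<in> ?T \<Longrightarrow> u \<in> contraction b N" by blast
    have "u / (p * x) * i \<in> D" if i: "i \<in> I" for i
    proof (rule locally_in_D)
      fix N assume N: "N \<in> t_Max D"
      show "\<exists>s\<in>D - N. s * (u / (p * x) * i) \<in> D"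
      proof (cases "N = M")
        case True
        obtain s d where s: "s \<in> D - M" "d \<in> D" "s * i = p * x * d" using Ix[OF i] by blast
        have "s * (u / (p * x) * i) = u * (s * i) / (p * x)" by (simp add: field_simps)
        also have "\<dots> = u * d" unfolding s(3) using p(2) x0 by simp
        finally show ?thesis using u(1) s(1,2) True mult_mem by (metis DiffD1)
      next
        case False
        have "\<exists>s\<in>D - N. \<exists>d\<in>D. s * u = b * d"
        proof (cases "b \<in> N")
          case True
          with u(2)[of N] N False show ?thesis by (auto simp: contraction_def)
        next
          case False
          with b u show ?thesis by blast
        qed
        then obtain s d where s: "s \<in> D - N" "d \<in> D" "s * u = b * d" by blast
        have "s * (u / (p * x) * i) = (s * u) * i / (p * x)" by (simp add: field_simps)
        also have "\<dots> = (d * e) * (d0 * i)" unfolding s(3) be using p(2) x0 by (simp add: field_simps)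
        finally show ?thesis using s(1) mult_mem[OF mult_mem[OF s(2) b(2)] d0(3)[OF i]] by metis
      qed
    qed
    then have "u / (p * x) * x \<in> D" using x unfolding v_closure_iff by blast
    then have "u / (p * x) * x * p \<in> M" using primeD(7)[OF pM _ p(1)] by blast
    with u(1) p(2) x0 show False by simp
  qed
qed


section \<open>The maximal ideal P D_P of D_P, and divisoriality of D_P\<close>

lemma submodule_extended_prime:
  assumes P: "prime_of P" "P \<noteq> {0}"
  shows "submodule_of (localize D P) {x. \<exists>s\<in>D - P. s * x \<in> P}"
proof -
  interpret L: frac_dom "localize D P" using frac_dom_localize[OF P] .
  let ?N = "{x. \<exists>s\<in>D - P. s * x \<in> P}"
  show ?thesis
    unfolding L.submodule_iff
  proof (intro conjI ballI)
    show "0 \<in> ?N" using primeD(5,11)[OF P(1)] by (intro CollectI bexI[of _ 1]) auto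
    fix x assume "x \<in> ?N"
    then obtain s where s: "s \<in> D - P" "s * x \<in> P" by blast
    { fix y assume "y \<in> ?N"
      then obtain t where t: "t \<in> D - P" "t * y \<in> P" by blast
      have "(s * t) * (x + y) = t * (s * x) + s * (t * y)" by (simp add: algebra_simps)
      also have "\<dots> \<in> P" using s t primeD(6,7)[OF P(1)] by auto
      finally show "x + y \<in> ?N" using primeD(10)[OF P(1) s(1) t(1)] by blast }
    { fix d assume "d \<in> localize D P"
      then obtain t where t: "t \<in> D - P" "t * d \<in> D" using localize_iff primeD(5)[OF P(1)] by blast
      have "(t * s) * (d * x) = (t * d) * (s * x)" by (simp add: mult_ac)
      also have "\<dots> \<in> P" using s t primeD(7)[OF P(1)] by blast
      finally show "d * x \<in> ?N" using primeD(10)[OF P(1) t(1) s(1)] by blast }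
  qed
qed

lemma localize_quotient: "P \<subseteq> D \<Longrightarrow> r \<in> D \<Longrightarrow> s \<in> D - P \<Longrightarrow> r / s \<in> localize D P"
  by (auto simp: localize_def)

lemma localize_unit:
  assumes P: "prime_of P" and s: "s \<in> localize D P" "\<not> (\<exists>t\<in>D - P. t * s \<in> P)"
  shows "1 / s \<in> localize D P"
proof -
  obtain t where t: "t \<in> D - P" "t * s \<in> D" using s(1) localize_iff primeD(5)[OF P] by blast
  with s(2) have "t * s \<in> D - P" by blast
  moreover from this have "1 / s = t / (t * s)" using primeD(12)[OF P t(1)] by simp
  ultimately show ?thesis using localize_quotient[OF primeD(2)[OF P], of t "t * s"] t by simp
qed

lemma principal_at_if_v_closed:
  assumes P: "prime_of P" "val_at P"
    and v: "v_closure (localize D P) {x. \<exists>s\<in>D - P. s * x \<in> P} \<subseteq> {x. \<exists>s\<in>D - P. s * x \<in> P}"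
      (is "v_closure ?V ?N \<subseteq> ?N")
  shows "principal_at P"
proof -
  note iff = localize_iff[OF primeD(5)[OF P(1)]]
  have "1 \<notin> ?N" by auto
  with v have "1 \<notin> v_closure ?V ?N" by blast
  then obtain x where x: "\<And>n. n \<in> ?N \<Longrightarrow> x * n \<in> ?V" "x \<notin> ?V"
    by (auto simp: v_closure_def colon_def)
  \<comment> \<open>Since x is not in D_P, its inverse r / u is, and r becomes the
    generator.\<close>
  obtain u r where u: "u \<in> D - P" "r \<in> D" "u = r * x"
  proof (rule val_atE[OF P(2), of x 1])
    fix u r assume "u \<in> D - P" "r \<in> D" "u * x = r * 1"
    then have False using x(2) by (auto simp: iff)
    then show thesis ..
  next
    fix u r assume "u \<in> D - P" "r \<in> D" "u * 1 = r * x"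
    with that show thesis by simp
  qed
  have "r \<in> P" using u x(2) iff by blast
  moreover have "\<exists>s\<in>D - P. \<exists>d\<in>D. s * m = r * d" if m: "m \<in> P" for m
  proof -
    have "m \<in> ?N" using m primeD(11)[OF P(1)] by (auto intro!: bexI[of _ 1])
    then obtain s where s: "s \<in> D - P" "s * (x * m) \<in> D" using x(1) iff by blast
    have "(s * u) * m = r * (s * (x * m))" unfolding u(3) by (simp add: mult_ac)
    with s primeD(10)[OF P(1) s(1) u(1)] show ?thesis by blast
  qed
  ultimately show ?thesis unfolding principal_at_def by blast
qed

lemma ideal_extended_prime:
  assumes P: "prime_of P" "P \<noteq> {0}"
  shows "ideal {x. \<exists>s\<in>D - P. s * x \<in> P} (ring_on (localize D P))"
    and "{x. \<exists>s\<in>D - P. s * x \<in> P} \<noteq> {0}"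
proof -
  interpret L: frac_dom "localize D P" using frac_dom_localize[OF P] .
  show "ideal {x. \<exists>s\<in>D - P. s * x \<in> P} (ring_on (localize D P))"
    using submodule_extended_prime[OF P] localize_iff[OF primeD(5)[OF P(1)]] primeD(9)[OF P(1)]
    by (auto simp: L.ideal_iff)
  obtain p where "p \<in> P" "p \<noteq> 0" using P(2) primeD(5)[OF P(1)] by blast
  with primeD(11)[OF P(1)] show "{x. \<exists>s\<in>D - P. s * x \<in> P} \<noteq> {0}"
    by (metis (mono_tags, lifting) mem_Collect_eq mult_1 singletonD)
qed

lemma principal_at_if_divisorial:
  assumes P: "prime_of P" "P \<noteq> {0}" "val_at P" and "divisorial_domain (localize D P)"
  shows "principal_at P"
  using assms(4) ideal_extended_prime[OF P(1,2)]
  by (intro principal_at_if_v_closed P) (auto simp: divisorial_domain_def divisorial_ideal_def)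

lemma principal_at_if_w_divisorial:
  assumes P: "prime_of P" "P \<noteq> {0}" "val_at P" and wd: "w_divisorial (localize D P)"
  shows "principal_at P"
proof -
  interpret L: frac_dom "localize D P" using frac_dom_localize[OF P(1,2)] .
  let ?V = "localize D P" and ?N = "{x. \<exists>s\<in>D - P. s * x \<in> P}"
  note N = submodule_extended_prime[OF P(1,2)]
  have sub: "?N \<subseteq> ?V" using ideal_extended_prime[OF P(1,2)] by (simp add: L.ideal_iff)
  have "1 \<notin> v_closure ?V F" if F: "finite F" "F \<subseteq> ?N" for F
  proof
    assume v: "1 \<in> v_closure ?V F"
    have "finite (insert 0 F)" "insert 0 F \<noteq> {}" using F by auto
    from common_divisor[OF P(1,3) this] obtain j s where
      j: "j \<in> insert 0 F" "s \<in> D - P" "\<forall>f\<in>F. \<exists>r\<in>D. s * f = r * j" by (metis insertI2)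
    have "F \<subseteq> (*) j ` ?V"
    proof
      fix f assume "f \<in> F"
      then obtain r where "r \<in> D" "s * f = r * j" using j by blast
      then have "f = j * (r / s)" using primeD(12)[OF P(1) j(2)] by (simp add: field_simps)
      with localize_quotient[OF primeD(2)[OF P(1)] \<open>r \<in> D\<close> j(2)] show "f \<in> (*) j ` ?V" by blast
    qed
    then have "1 \<in> (*) j ` ?V" using L.v_closure_subset_principal v by blast
    moreover have "j \<in> ?N" using j(1) F(2) L.submoduleD(1)[OF N] by blast
    ultimately have "1 \<in> ?N" using L.submoduleD(4)[OF N] by (metis (no_types, lifting) imageE)
    then show False by auto
  qed
  then obtain M where M: "M \<in> t_Max ?V" "?N \<subseteq> M" using L.ex_t_max[OF N sub] by blast
  have "w_ideal ?V ?N"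
  proof (rule L.w_idealI[OF N ideal_extended_prime(2)[OF P(1,2)], of 1])
    fix x assume "\<And>M. M \<in> t_Max ?V \<Longrightarrow> \<exists>s\<in>?V - M. s * x \<in> ?N"
    from this[OF M(1)] obtain s where s: "s \<in> ?V" "s \<notin> ?N" "s * x \<in> ?N" using M(2) by blast
    have "1 / s \<in> ?V" by (rule localize_unit[OF P(1) s(1)]) (use s(2) in blast)
    then have "1 / s * (s * x) \<in> ?N" using L.submoduleD(3)[OF N _ s(3)] by blast
    moreover have "s \<noteq> 0" using s(2) L.submoduleD(1)[OF N] by blast
    then have "1 / s * (s * x) = x" by simp
    ultimately show "x \<in> ?N" by metis
  qed (use sub in auto)
  then have "v_closure ?V ?N \<subseteq> ?N" using wd unfolding L.w_divisorial_iff by blast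
  then show ?thesis using principal_at_if_v_closed[OF P(1,3)] by blast
qed

text \<open>For x outside a nonzero ideal I of V = D_P, comparing each i in I with x shows that I is
  contained in p x V, where p generates P D_P. This is principal, so it contains I_v, but it misses
  x because p is no unit.\<close>

lemma divisorial_localize:
  assumes P: "prime_of P" "P \<noteq> {0}" "val_at P" and pr: "principal_at P"
  shows "divisorial_domain (localize D P)"
proof -
  interpret L: frac_dom "localize D P" using frac_dom_localize[OF P(1,2)] .
  let ?V = "localize D P"
  note quot = localize_quotient[OF primeD(2)[OF P(1)]] and nz = primeD(12)[OF P(1)]
  obtain p where p: "p \<in> P" "p \<noteq> 0" "\<And>m. m \<in> P \<Longrightarrow> \<exists>s\<in>D - P. \<exists>d\<in>D. s * m = p * d"
    using principal_atE[OF pr P(1,2)] by metis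
  have "divisorial_ideal ?V I" if I: "ideal I (ring_on ?V)" "I \<noteq> {0}" for I
  proof -
    have I': "submodule_of ?V I" "I \<subseteq> ?V" using I by (auto simp: L.ideal_iff)
    have "v_closure ?V I \<subseteq> I"
    proof
      fix x assume x: "x \<in> v_closure ?V I"
      show "x \<in> I"
      proof (rule ccontr)
        assume nx: "x \<notin> I"
        then have x0: "x \<noteq> 0" using L.submoduleD(1)[OF I'(1)] by blast
        have "I \<subseteq> (*) (p * x) ` ?V"
        proof
          fix i assume i: "i \<in> I"
          show "i \<in> (*) (p * x) ` ?V"
          proof (rule val_atE[OF P(3), of x i])
            fix u r assume u: "u \<in> D - P" "r \<in> D" "u * x = r * i"
            then have "x = (r / u) * i" using nz[OF u(1)] by (simp add: field_simps)
            with nx L.submoduleD(3)[OF I'(1) quot[OF u(2,1)] i] show ?thesis by simp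
          next
            fix u r assume u: "u \<in> D - P" "r \<in> D" "u * i = r * x"
            show ?thesis
            proof (cases "r \<in> P")
              case True
              then obtain s d where s: "s \<in> D - P" "d \<in> D" "s * r = p * d" using p(3) by blast
              have "(s * u) * i = (s * r) * x" using u by (simp add: mult.assoc)
              also have "\<dots> = p * x * d" unfolding s(3) by (simp add: mult_ac)
              finally have "i = (p * x) * (d / (s * u))"
                using nz[OF u(1)] nz[OF s(1)] by (simp add: field_simps)
              with quot[OF s(2) primeD(10)[OF P(1) s(1) u(1)]] show ?thesis by blast
            next
              case False
              with u have r: "r \<in> D - P" by blast
              then have "x = (u / r) * i" using u nz[OF r] by (simp add: field_simps)
              moreover have "(u / r) * i \<in> I"
                using u by (intro L.submoduleD(3)[OF I'(1) quot[OF _ r] i]) blast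
              ultimately have "x \<in> I" by metis
              with nx show ?thesis ..
            qed
          qed
        qed
        then have "x \<in> (*) (p * x) ` ?V" using L.v_closure_subset_principal x by blast
        then obtain v where v: "v \<in> ?V" "x = p * x * v" by blast
        then have "x * (p * v) = x * 1" by (metis mult.assoc mult.commute mult_1_right)
        then have "p * v = 1" using x0 mult_left_cancel by blast
        obtain s where s: "s \<in> D - P" "s * v \<in> D" using v(1) localize_iff[OF primeD(5)[OF P(1)]] by blast
        have "s = (s * v) * p" using \<open>p * v = 1\<close> by (metis mult.assoc mult.commute mult_1)
        with primeD(7)[OF P(1) s(2) p(1)] s(1) show False by simp
      qed
    qed
    then show ?thesis
      using I(2) I' L.fractional_integral L.subset_v_closure[of I]
      by (auto simp: divisorial_ideal_def nonzero_fractional_ideal_def)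
  qed
  then show ?thesis by (simp add: divisorial_domain_def)
qed

section \<open>Integral closure\<close>

lemma w_closure_w_ideal:
  assumes "submodule_of D I" "I \<noteq> {0}" "d \<in> D" "d \<noteq> 0" "\<And>x. x \<in> I \<Longrightarrow> d * x \<in> D"
  shows "w_ideal D (w_closure D I)"
proof (rule w_idealI[OF _ _ assms(3,4)])
  note iff = w_closure_iff[OF assms(1)] and I = assms(1)
  show "submodule_of D (w_closure D I)"
    unfolding submodule_iff iff
  proof (intro conjI ballI)
    fix M assume M: "M \<in> t_Max D"
    show "\<exists>s\<in>D - M. s * 0 \<in> I" using submoduleD(1)[OF I] t_maxD(5)[OF M] by (intro bexI[of _ 1]) auto
  next
    fix x y M assume xy: "x \<in> w_closure D I" "y \<in> w_closure D I" and M: "M \<in> t_Max D"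
    from xy M obtain s t where s: "s \<in> D - M" "s * x \<in> I" "t \<in> D - M" "t * y \<in> I" unfolding iff by blast
    have "(s * t) * (x + y) = t * (s * x) + s * (t * y)" by (simp add: algebra_simps)
    also have "\<dots> \<in> I" using s submoduleD(2,3)[OF I] by auto
    finally show "\<exists>s\<in>D - M. s * (x + y) \<in> I" using primeD(10)[OF prime_t_max[OF M] s(1,3)] by blast
  next
    fix d x M assume d: "d \<in> D" and x: "x \<in> w_closure D I" and M: "M \<in> t_Max D"
    then obtain s where s: "s \<in> D - M" "s * x \<in> I" unfolding iff by blast
    then have "d * (s * x) \<in> I" using d submoduleD(3)[OF I] by blast
    with s show "\<exists>s\<in>D - M. s * (d * x) \<in> I" by (metis mult.left_commute)
  qed
  obtain a where "a \<in> I" "a \<noteq> 0" using assms(2) submoduleD(1)[OF I] by blast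
  then show "w_closure D I \<noteq> {0}" using subset_w_closure[OF I] by blast
  show "d * x \<in> D" if "x \<in> w_closure D I" for x
  proof (rule locally_in_D)
    fix M assume "M \<in> t_Max D"
    with that obtain s where "s \<in> D - M" "s * x \<in> I" unfolding iff by blast
    with assms(5)[of "s * x"] show "\<exists>s\<in>D - M. s * (d * x) \<in> D" by (metis mult.left_commute)
  qed
  show "x \<in> w_closure D I" if x: "\<And>M. M \<in> t_Max D \<Longrightarrow> \<exists>s\<in>D - M. s * x \<in> w_closure D I" for x
    unfolding iff
  proof
    fix M assume M: "M \<in> t_Max D"
    with x obtain s where s: "s \<in> D - M" "s * x \<in> w_closure D I" by blast
    with M obtain t where t: "t \<in> D - M" "t * (s * x) \<in> I" unfolding iff by blast
    with primeD(10)[OF prime_t_max[OF M] t(1) s(1)] show "\<exists>s\<in>D - M. s * x \<in> I"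
      by (metis mult.assoc)
  qed
qed

lemma integrally_closed_quadratic:
  assumes "integrally_closed D" "b \<in> D" "c \<in> D" "y * y = b * y + c"
  shows "y \<in> D"
proof -
  let ?p = "[:- c, - b, 1:]"
  have "lead_coeff ?p = 1" by simp
  moreover have "coeff ?p i \<in> D" for i
    using assms(2,3) uminus_mem by (auto simp: coeff_pCons split: nat.splits)
  moreover have "poly ?p y = 0" using assms(4) by (simp add: algebra_simps)
  ultimately show ?thesis using assms(1) unfolding integrally_closed_def by blast
qed

text \<open>For \<open>J = aD + bD\<close>, an element \<open>x\<close> multiplying \<open>J (D : J)\<close> into \<open>D\<close> stabilises
  \<open>J\<^sub>v = J\<^sub>w\<close>, hence is integral over \<open>D\<close>; so the \<open>v\<close>-closure of
  \<open>J (D : J)\<close> is \<open>D\<close> and, again by \<open>w\<close>-divisoriality, \<open>J\<close> is locally invertible.\<close>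

theorem w_divisorial_integrally_closed_imp_PvMD:
  assumes ic: "integrally_closed D" and wd: "w_divisorial D"
  shows "PvMD D"
  unfolding PvMD_iff
proof
  fix M assume M: "M \<in> t_Max D"
  note pM = prime_t_max[OF M]
  have main: "\<exists>u\<in>D - M. \<exists>r\<in>D. u * a = r * b \<or> u * b = r * a"
    if ab: "a \<in> D" "b \<in> D" "a \<noteq> 0" "b \<noteq> 0" for a b
  proof -
    \<comment> \<open>\<open>G\<close> is (D : J) and \<open>I\<close> is J (D : J), both expressed
      through the generators a and b of J.\<close>
    define J where "J = {a * d + b * e |d e. d \<in> D \<and> e \<in> D}"
    define G where "G = colon D {a, b}"
    define I where "I = {a * g + b * h |g h. g \<in> G \<and> h \<in> G}"
    have G: "g \<in> G \<longleftrightarrow> a * g \<in> D \<and> b * g \<in> D" for g by (auto simp: G_def colon_def mult.commute)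
    have sG: "submodule_of D G"
      by (auto simp: submodule_iff G distrib_left mult.left_commute[of _ "_ :: 'a"] add_mem mult_mem)
    have comb: "submodule_of D {a * d + b * e |d e. d \<in> S \<and> e \<in> S}" if S: "submodule_of D S" for S
      unfolding submodule_iff
    proof (intro conjI ballI)
      show "0 \<in> {a * d + b * e |d e. d \<in> S \<and> e \<in> S}" using submoduleD(1)[OF S] by force
      fix x assume "x \<in> {a * d + b * e |d e. d \<in> S \<and> e \<in> S}"
      then obtain d e where x: "x = a * d + b * e" "d \<in> S" "e \<in> S" by blast
      { fix y assume "y \<in> {a * d + b * e |d e. d \<in> S \<and> e \<in> S}"
        then obtain f g where y: "y = a * f + b * g" "f \<in> S" "g \<in> S" by blast
        have "x + y = a * (d + f) + b * (e + g)" unfolding x y by (simp add: algebra_simps)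
        with x y submoduleD(2)[OF S] show "x + y \<in> {a * d + b * e |d e. d \<in> S \<and> e \<in> S}" by blast }
      { fix c assume c: "c \<in> D"
        have "c * x = a * (c * d) + b * (c * e)" unfolding x by (simp add: algebra_simps)
        with x c submoduleD(3)[OF S] show "c * x \<in> {a * d + b * e |d e. d \<in> S \<and> e \<in> S}" by blast }
    qed
    have "submodule_of D D" by (simp add: submodule_iff add_mem mult_mem)
    then have sJ: "submodule_of D J" and sI: "submodule_of D I"
      using comb[of D] comb[OF sG] by (simp_all add: J_def I_def)
    have "a * 1 + b * 0 \<in> J" "a * 0 + b * 1 \<in> J" unfolding J_def using one_mem zero_mem by blast+
    then have abJ: "a \<in> J" "b \<in> J" by simp_all
    have JD: "J \<subseteq> D" using ab add_mem mult_mem by (auto simp: J_def)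
    have ID: "I \<subseteq> D" using add_mem by (auto simp: I_def G)
    have "1 \<in> G" "0 \<in> G" using ab by (auto simp: G)
    then have "a * 1 + b * 0 \<in> I" unfolding I_def by blast
    then have aI: "a \<in> I" by simp
    have wJ: "w_ideal D (w_closure D J)"
      using abJ ab JD by (intro w_closure_w_ideal[OF sJ, of 1]) auto
    have wI: "w_ideal D (w_closure D I)"
      using aI ab ID by (intro w_closure_w_ideal[OF sI, of 1]) auto
    have x_in: "x \<in> D" if x: "\<And>i. i \<in> I \<Longrightarrow> x * i \<in> D" for x
    proof -
      have xG: "x * g \<in> G" if "g \<in> G" for g
      proof -
        have "a * g + b * 0 \<in> I" "a * 0 + b * g \<in> I"
          using that \<open>0 \<in> G\<close> unfolding I_def by blast+
        with x[of "a * g"] x[of "b * g"] show ?thesis by (simp add: G mult.left_commute)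
      qed
      \<comment> \<open>x maps (D : J) into itself, so x * c lies in J_v, which is contained in J_w
        because J_w is divisorial.\<close>
      have "x * c \<in> w_closure D J" if c: "c = a \<or> c = b" for c
      proof -
        have "x * c \<in> v_closure D {a, b}"
          unfolding v_closure_iff
        proof (intro allI impI)
          fix g assume "\<forall>f\<in>{a, b}. g * f \<in> D"
          then have "x * g \<in> G" by (intro xG) (auto simp: G mult.commute)
          with c show "g * (x * c) \<in> D" by (auto simp: G mult_ac)
        qed
        moreover have "{a, b} \<subseteq> w_closure D J" using abJ subset_w_closure[OF sJ] by blast
        ultimately show ?thesis
          using v_closure_mono wd wJ unfolding w_divisorial_iff by blast
      qed
      then have xab: "x * a \<in> w_closure D J" "x * b \<in> w_closure D J" by auto
      show "x \<in> D"
      proof (rule locally_in_D)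
        fix N assume N: "N \<in> t_Max D"
        from xab N obtain s t where st: "s \<in> D - N" "s * (x * a) \<in> J" "t \<in> D - N" "t * (x * b) \<in> J"
          unfolding w_closure_iff[OF sJ] by blast
        let ?y = "(s * t) * x"
        have "t * (s * (x * a)) \<in> J" "s * (t * (x * b)) \<in> J"
          using st submoduleD(3)[OF sJ] by blast+
        then obtain \<alpha> \<beta> \<gamma> \<delta> where
          D: "\<alpha> \<in> D" "\<beta> \<in> D" "\<gamma> \<in> D" "\<delta> \<in> D" and
          eq: "?y * a = a * \<alpha> + b * \<beta>" "?y * b = a * \<gamma> + b * \<delta>"
          unfolding J_def by (auto simp: mult_ac)
        \<comment> \<open>Determinant trick for the 2 by 2 system that describes the action of
          \<open>?y\<close> on a and b; cancelling a * b leaves a monic quadratic equation for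
          \<open>?y\<close>.\<close>
        have "(?y - \<alpha>) * a = b * \<beta>" "(?y - \<delta>) * b = a * \<gamma>"
          using eq by (simp_all add: algebra_simps)
        then have "((?y - \<alpha>) * a) * ((?y - \<delta>) * b) = (b * \<beta>) * (a * \<gamma>)" by simp
        then have "(a * b) * ((?y - \<alpha>) * (?y - \<delta>)) = (a * b) * (\<beta> * \<gamma>)"
          by (simp only: mult_ac)
        then have "(?y - \<alpha>) * (?y - \<delta>) = \<beta> * \<gamma>" using ab(3,4) by simp
        then have root: "?y * ?y = (\<alpha> + \<delta>) * ?y + (\<beta> * \<gamma> - \<alpha> * \<delta>)"
          by (simp add: algebra_simps)
        have "\<alpha> + \<delta> \<in> D" "\<beta> * \<gamma> - \<alpha> * \<delta> \<in> D"
          using D by (simp_all add: add_mem diff_mem mult_mem)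
        then have "?y \<in> D" using integrally_closed_quadratic[OF ic _ _ root] by blast
        then show "\<exists>s\<in>D - N. s * x \<in> D" using primeD(10)[OF prime_t_max[OF N] st(1,3)] by blast
      qed
    qed
    then have "1 \<in> v_closure D I" by (auto simp: v_closure_iff)
    then have "1 \<in> w_closure D I"
      using v_closure_mono[OF subset_w_closure[OF sI]] wI wd unfolding w_divisorial_iff by blast
    then obtain s where "s \<in> D - M" "s * 1 \<in> I" using M unfolding w_closure_iff[OF sI] by blast
    then obtain g h where gh: "g \<in> G" "h \<in> G" "a * g + b * h \<notin> M" by (auto simp: I_def)
    \<comment> \<open>If a * g is outside M, it is a unit of D_M, and (a * g) * b = (b * g) * a
      makes b a multiple of a there; b * h works symmetrically.\<close>
    then have "a * g \<in> D - M \<or> b * h \<in> D - M" using G primeD(6)[OF pM] by blast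
    then show ?thesis
    proof
      assume "a * g \<in> D - M"
      moreover have "(a * g) * b = (b * g) * a" by (simp add: mult_ac)
      ultimately show ?thesis using gh(1) G by blast
    next
      assume "b * h \<in> D - M"
      moreover have "(b * h) * a = (a * h) * b" by (simp add: mult_ac)
      ultimately show ?thesis using gh(2) G by blast
    qed
  qed
  show "val_at M"
    unfolding val_at_def
  proof (intro allI)
    fix x y
    obtain a s b t where x: "a \<in> D" "s \<in> D" "s \<noteq> 0" "x = a / s" and y: "b \<in> D" "t \<in> D" "t \<noteq> 0" "y = b / t"
      using quotient[of x] quotient[of y] by blast
    show "\<exists>u\<in>D - M. \<exists>r\<in>D. u * x = r * y \<or> u * y = r * x"
    proof (cases "a = 0 \<or> b = 0")
      case True
      then have "1 * x = 0 * y \<or> 1 * y = 0 * x" using x y by auto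
      then show ?thesis using primeD(11)[OF pM] zero_mem by blast
    next
      case False
      then obtain u r where u: "u \<in> D - M" "r \<in> D" "u * (a * t) = r * (b * s) \<or> u * (b * s) = r * (a * t)"
        using main[of "a * t" "b * s"] x y mult_mem by auto
      then have "u * x = r * y \<or> u * y = r * x" unfolding x y using x(3) y(3) by (simp add: field_simps)
      with u show ?thesis by blast
    qed
  qed
qed

text \<open>When 1 / x is in the valuation domain D_M, dividing the equation of degree n + 1 by x^n
  writes x as a polynomial in 1 / x. So x is in every D_M and hence in D.\<close>

lemma PvMD_imp_integrally_closed:
  assumes "PvMD D"
  shows "integrally_closed D"
  unfolding integrally_closed_def
proof (intro allI impI)
  fix x assume "\<exists>p. lead_coeff p = 1 \<and> (\<forall>i. coeff p i \<in> D) \<and> poly p x = 0"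
  then obtain p where p: "lead_coeff p = 1" "\<And>i. coeff p i \<in> D" "poly p x = 0" by blast
  show "x \<in> D"
  proof (cases "x = 0")
    case False
    show ?thesis
    proof (rule locally_in_D)
      fix M assume M: "M \<in> t_Max D"
      note pM = prime_t_max[OF M]
      interpret L: frac_dom "localize D M" using frac_dom_localize[OF pM t_maxD(3)[OF M]] .
      have "x \<in> localize D M"
      proof (cases "1 / x \<in> localize D M")
        case False
        then show ?thesis
          using assms M \<open>x \<noteq> 0\<close> by (auto simp: PvMD_def valuation_domain_def inverse_eq_divide)
      next
        case True
        obtain n where n: "degree p = Suc n"
        proof (cases "degree p")
          case 0
          then have "p = 1" using p(1) by (metis degree_eq_zeroE lead_coeff_pCons(2) one_pCons)
          with p(3) show ?thesis by simp
        qed blast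
        have "(\<Sum>i\<le>Suc n. coeff p i * x ^ i) = 0" using p(3) by (simp add: poly_altdef n)
        then have "x ^ Suc n = - (\<Sum>i\<le>n. coeff p i * x ^ i)"
          using p(1) n by (simp add: eq_neg_iff_add_eq_0 add.commute)
        then have "x = - (\<Sum>i\<le>n. coeff p i * x ^ i) * (1 / x) ^ n"
          using \<open>x \<noteq> 0\<close> by (simp add: field_simps)
        also have "\<dots> = - (\<Sum>i\<le>n. coeff p i * (1 / x) ^ (n - i))"
        proof -
          have "coeff p i * x ^ i * (1 / x) ^ n = coeff p i * (1 / x) ^ (n - i)" if "i \<le> n" for i
            using \<open>x \<noteq> 0\<close> that by (simp add: power_diff field_simps)
          then have "(\<Sum>i\<le>n. coeff p i * x ^ i * (1 / x) ^ n) = (\<Sum>i\<le>n. coeff p i * (1 / x) ^ (n - i))"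
            by (intro sum.cong refl) blast
          then show ?thesis by (simp only: sum_distrib_right mult_minus_left)
        qed
        also have "\<dots> \<in> localize D M"
        proof (rule L.uminus_mem)
          have "coeff p i * (1 / x) ^ (n - i) \<in> localize D M" for i
            using L.mult_mem L.power_mem[OF True] p(2) D_subset_localize[OF t_maxD(5)[OF M]] by blast
          then show "(\<Sum>i\<le>n. coeff p i * (1 / x) ^ (n - i)) \<in> localize D M"
            by (rule L.sum_mem)
        qed
        finally show ?thesis .
      qed
      then show "\<exists>s\<in>D - M. s * x \<in> D" using localize_iff primeD(5)[OF pM] by blast
    qed
  qed simp
qed


section \<open>Overrings\<close>

lemma frac_dom_overring:
  assumes "overring D T" "T \<noteq> UNIV"
  shows "frac_dom T"
  using assms quotient
  by (intro frac_domI) (auto simp: overring_def has_quotient_field_def, blast)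

text \<open>The contraction does not collapse to zero: a nonzero element a / b of N has its
  numerator a = b * (a / b) in N.\<close>

lemma prime_Int_overring:
  assumes T: "overring D T" "T \<noteq> UNIV" and N: "primeideal N (ring_on T)" "N \<noteq> {0}"
  shows "prime_of (N \<inter> D)" "N \<inter> D \<noteq> {0}" "D - N \<inter> D \<subseteq> T - N"
    "localize D (N \<inter> D) \<subseteq> localize T N"
proof -
  interpret T: frac_dom T using frac_dom_overring[OF T] .
  have DT: "D \<subseteq> T" using T by (simp add: overring_def)
  show "prime_of (N \<inter> D)"
    unfolding primeideal_iff submodule_iff
    using T.primeD[OF N(1)] DT add_mem mult_mem by (auto simp: subset_iff)
  obtain x where x: "x \<in> N" "x \<noteq> 0" using N T.primeD(5) by blast
  obtain a b where ab: "a \<in> D" "b \<in> D" "b \<noteq> 0" "x = a / b" using quotient by blast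
  have "b * x \<in> N" using T.primeD(7)[OF N(1)] ab(2) DT x(1) by blast
  with ab x(2) have "a \<in> N \<inter> D" "a \<noteq> 0" by auto
  then show "N \<inter> D \<noteq> {0}" by blast
  show "D - N \<inter> D \<subseteq> T - N" using DT by blast
  then show "localize D (N \<inter> D) \<subseteq> localize T N" using DT unfolding localize_def by blast
qed

lemma overring_localize:
  assumes "prime_of P" "P \<noteq> {0}"
  shows "overring D (localize D P)"
  using frac_dom.ring_D[OF frac_dom_localize[OF assms]] D_subset_localize[OF primeD(3)[OF assms(1)]]
  by (simp add: overring_def)

lemma t_flat_self: "t_flat D D"
  using t_maxD(4) by (auto simp: t_flat_def Int_absorb2)

text \<open>A denominator in D_P is brought into D by factors outside P, which are units of D_P and
  so do not move it into N. Thus D_P is a test ring for the condition on t-flat overrings.\<close>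

lemma t_flat_localize:
  assumes P: "prime_of P" "P \<noteq> {0}"
  shows "t_flat D (localize D P)"
  unfolding t_flat_def
proof (intro disjI2 ballI)
  let ?V = "localize D P"
  interpret L: frac_dom ?V using frac_dom_localize[OF P] .
  note T = overring_localize[OF P] L.proper
  note iff = localize_iff[OF primeD(5)[OF P(1)]]
  fix N assume N: "N \<in> t_Max ?V"
  note pN = L.prime_t_max[OF N]
  note cN = prime_Int_overring[OF T pN L.t_maxD(3)[OF N]]
  show "localize ?V N = localize D (N \<inter> D)"
  proof
    show "localize ?V N \<subseteq> localize D (N \<inter> D)"
    proof
      fix x assume "x \<in> localize ?V N"
      then obtain s where s: "s \<in> ?V - N" "s * x \<in> ?V" using L.localize_iff L.primeD(5)[OF pN] by blast
      then obtain t u where t: "t \<in> D - P" "t * s \<in> D" "u \<in> D - P" "u * (s * x) \<in> D" using iff by blast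
      have tu: "t * u \<in> D - P" using primeD(10)[OF P(1) t(1,3)] .
      have "t * (u * (s * x)) \<in> D" "u * (t * s) \<in> D" using t mult_mem by blast+
      then have 1: "(t * u * s) * x \<in> D" "t * u * s \<in> D" by (simp_all only: mult_ac)
      have "t * u * s \<notin> N"
      proof
        assume "t * u * s \<in> N"
        moreover have "1 / (t * u) \<in> ?V" using localize_quotient[OF primeD(2)[OF P(1)] one_mem tu] .
        ultimately have "1 / (t * u) * (t * u * s) \<in> N" using L.primeD(7)[OF pN] by blast
        then show False using primeD(12)[OF P(1) tu] s(1) by simp
      qed
      with 1 show "x \<in> localize D (N \<inter> D)" using localize_iff[OF primeD(5)[OF cN(1)]] by blast
    qed
  qed (rule cN(4))
qed

text \<open>Let x J be contained in T, with J generated by a finite F. At a t-maximal N of T,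
  flatness puts x F into D_Q with Q = N \<inter> D; one denominator c serves all of F, so c * x is
  in (D : J) = D. Thus x is in every T_N.\<close>

lemma t_flat_imp_t_linked:
  assumes T: "overring D T" and flat: "t_flat D T"
  shows "t_linked D T"
  unfolding t_linked_def
proof (intro allI impI)
  fix J assume "ideal J (ring_on D) \<and> J \<noteq> {0} \<and> finitely_generated D J \<and> colon D J = D"
  then obtain F where J: "J \<subseteq> D" "colon D J = D" "finite F" "J = submodule_of D hull F"
    by (auto simp: ideal_iff finitely_generated_def)
  have DT: "D \<subseteq> T" "ring (ring_on T)" using T by (auto simp: overring_def)
  have FJ: "F \<subseteq> J" unfolding J(4) by (rule hull_subset)
  show "colon T (frac_prod J T) = T"
  proof
    show "T \<subseteq> colon T (frac_prod J T)"
    proof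
      fix t assume t: "t \<in> T"
      have "frac_prod J T \<subseteq> T"
        using J(1) DT(1) ring_onD[OF DT(2)] by (intro frac_prod_least) auto
      with t show "t \<in> colon T (frac_prod J T)" using ring_onD(4)[OF DT(2)] by (auto simp: colon_def)
    qed
    show "colon T (frac_prod J T) \<subseteq> T"
    proof (cases "T = UNIV")
      case False
      interpret T: frac_dom T using frac_dom_overring[OF T False] .
      show ?thesis
      proof
        fix x assume x: "x \<in> colon T (frac_prod J T)"
        have xf: "x * f \<in> T" if "f \<in> F" for f
        proof -
          have "f * 1 \<in> frac_prod J T" using that FJ by (intro frac_prod_mem) auto
          with x show ?thesis by (auto simp: colon_def)
        qed
        show "x \<in> T"
        proof (rule T.locally_in_D)
          fix N assume N: "N \<in> t_Max T"
          note pN = T.prime_t_max[OF N]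
          note Q = prime_Int_overring[OF T False pN T.t_maxD(3)[OF N]]
          have eq: "localize T N = localize D (N \<inter> D)" using flat N False by (auto simp: t_flat_def)
          have "\<exists>c\<in>D - N \<inter> D. \<forall>f\<in>F. c \<in> {c. c * (x * f) \<in> D}"
          proof (rule ex_avoiding_prime[OF Q(1) J(3) submodule_multiples])
            fix f assume "f \<in> F"
            then have "x * f \<in> localize D (N \<inter> D)"
              using xf T.D_subset_localize[OF T.t_maxD(5)[OF N]] eq by blast
            then show "\<exists>c\<in>D - N \<inter> D. c \<in> {c. c * (x * f) \<in> D}"
              using localize_iff[OF primeD(5)[OF Q(1)]] by blast
          qed
          then obtain c where c: "c \<in> D - N \<inter> D" "\<And>f. f \<in> F \<Longrightarrow> c * (x * f) \<in> D" by blast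
          have "J \<subseteq> {y. y * (c * x) \<in> D}"
            unfolding J(4) using c(2) by (intro hull_least submodule_multiples) (auto simp: mult_ac)
          then have "c * x \<in> colon D J" by (auto simp: colon_def mult.commute)
          then have "c * x \<in> D" using J(2) by simp
          with c(1) Q(3) DT(1) show "\<exists>s\<in>T - N. s * x \<in> T" by blast
        qed
      qed
    qed simp
  qed
qed

text \<open>If Q = N \<inter> D were in no t-maximal ideal, a finite subset of Q would have 1 in its
  v-closure over D; t-linkedness carries this over to T, where N forbids it. The localizations agree
  because T_N dominates the valuation domain D_Q.\<close>

lemma t_linked_center:
  assumes pv: "PvMD D" and T: "overring D T" "T \<noteq> UNIV" and link: "t_linked D T" and N: "N \<in> t_Max T"
  shows "\<exists>M\<in>t_Max D. N \<inter> D \<subseteq> M" "localize T N = localize D (N \<inter> D)"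
proof -
  interpret T: frac_dom T using frac_dom_overring[OF T] .
  note pN = T.prime_t_max[OF N]
  note Q = prime_Int_overring[OF T pN T.t_maxD(3)[OF N]]
  have DT: "D \<subseteq> T" using T by (auto simp: overring_def)
  show "\<exists>M\<in>t_Max D. N \<inter> D \<subseteq> M"
  proof (rule ex_t_max[OF primeD(1,2)[OF Q(1)]], rule notI)
    fix F assume F: "finite F" "F \<subseteq> N \<inter> D" "1 \<in> v_closure D F"
    define J where "J = submodule_of D hull F"
    have "F \<subseteq> J" unfolding J_def by (rule hull_subset)
    have sD: "submodule_of D D" by (simp add: submodule_iff add_mem mult_mem)
    have J: "submodule_of D J" "J \<subseteq> D"
      unfolding J_def using hull_least[OF sD] F(2) submodule_hull by auto
    have "J \<noteq> {0}"
    proof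
      assume "J = {0}"
      then have "1 \<in> v_closure D {0}" using F(3) v_closure_hull[of F] by (simp add: J_def)
      moreover have "{0} \<subseteq> (*) 0 ` D" by (auto intro: image_eqI[of _ _ 0])
      ultimately have "1 \<in> (*) 0 ` D" using v_closure_subset_principal[of "{0}" 0] by blast
      then show False by auto
    qed
    moreover have "colon D J = D"
    proof
      show "D \<subseteq> colon D J" using J(2) mult_mem by (auto simp: colon_def)
      show "colon D J \<subseteq> D"
      proof
        fix x assume "x \<in> colon D J"
        then have "\<forall>f\<in>F. x * f \<in> D" using \<open>F \<subseteq> J\<close> by (auto simp: colon_def)
        then have "x * 1 \<in> D" using F(3) unfolding v_closure_iff by blast
        then show "x \<in> D" by simp
      qed
    qed
    ultimately have col: "colon T (frac_prod J T) = T"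
      using link J F(1) unfolding t_linked_def ideal_iff finitely_generated_def J_def by blast
    have "1 \<in> v_closure T F"
      unfolding T.v_closure_iff
    proof (intro allI impI)
      fix c assume c: "\<forall>f\<in>F. c * f \<in> T"
      have "submodule_of D {y. y * c \<in> T}"
        using T.submodule_multiples[of c] DT by (auto simp: submodule_iff T.submodule_iff)
      then have JY: "J \<subseteq> {y. y * c \<in> T}"
        unfolding J_def using c by (intro hull_least) (auto simp: mult.commute)
      have "frac_prod J T \<subseteq> {y. y * c \<in> T}"
      proof (rule frac_prod_least)
        fix a b assume "a \<in> J" "b \<in> T"
        then have "b * (a * c) \<in> T" using JY T.mult_mem by blast
        then show "a * b \<in> {y. y * c \<in> T}" by (simp add: mult_ac)
      qed (simp add: distrib_right T.add_mem)
      then have "c \<in> colon T (frac_prod J T)" by (auto simp: colon_def mult.commute)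
      with col show "c * 1 \<in> T" by simp
    qed
    with T.t_max_not_v[OF N F(1)] F(2) show False by blast
  qed
  then obtain M where M: "M \<in> t_Max D" "N \<inter> D \<subseteq> M" by blast
  then have val: "val_at (N \<inter> D)" using pv val_at_mono by (auto simp: PvMD_iff)
  show "localize T N = localize D (N \<inter> D)"
  proof
    show "localize T N \<subseteq> localize D (N \<inter> D)"
    proof
      fix x assume x: "x \<in> localize T N"
      note iff = localize_iff[OF primeD(5)[OF Q(1)]]
      show "x \<in> localize D (N \<inter> D)"
      proof (rule val_atE[OF val, of x 1])
        fix u r assume "u \<in> D - N \<inter> D" "r \<in> D" "u * x = r * 1"
        then show ?thesis unfolding iff by auto
      next
        fix u r assume u: "u \<in> D - N \<inter> D" "r \<in> D" "u * 1 = r * x"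
        obtain s where s: "s \<in> T - N" "s * x \<in> T" using x T.localize_iff T.primeD(5)[OF pN] by blast
        have "r \<notin> N"
        proof
          assume "r \<in> N"
          then have "(s * x) * r \<in> N" using T.primeD(7)[OF pN s(2)] by blast
          moreover have "(s * x) * r = s * u" using u(3) by (simp add: mult_ac)
          ultimately show False using T.primeD(10)[OF pN s(1), of u] u(1) Q(3) by auto
        qed
        with u show ?thesis unfolding iff by auto
      qed
    qed
  qed (rule Q(4))
qed

lemma primes_comparable:
  assumes M: "val_at M" and P: "prime_of P" "prime_of Q" "P \<subseteq> M" "Q \<subseteq> M"
  shows "P \<subseteq> Q \<or> Q \<subseteq> P"
proof (rule ccontr)
  assume "\<not> (P \<subseteq> Q \<or> Q \<subseteq> P)"
  then obtain a b where ab: "a \<in> P" "a \<notin> Q" "b \<in> Q" "b \<notin> P" by blast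
  then have D: "a \<in> D" "b \<in> D" using P primeD(9) by blast+
  show False
  proof (rule val_atE[OF M, of a b])
    fix u r assume u: "u \<in> D - M" "r \<in> D" "u * a = r * b"
    then have "u * a \<in> Q" using primeD(7)[OF P(2)] ab by simp
    with primeD(4)[OF P(2), of u a] u D ab P(4) show False by blast
  next
    fix u r assume u: "u \<in> D - M" "r \<in> D" "u * b = r * a"
    then have "u * b \<in> P" using primeD(7)[OF P(1)] ab by simp
    with primeD(4)[OF P(1), of u b] u D ab P(3) show False by blast
  qed
qed

text \<open>The criterion \<open>w_divisorialI\<close> is verified for T through the centres N
  \<inter> D. These are t-primes of D, not necessarily t-maximal, which is why principality is
  assumed at all t-primes. T = K counts as a field.\<close>

theorem t_linked_w_divisorial:
  assumes pv: "PvMD D" and pr: "\<And>P. P \<in> t_Spec D \<Longrightarrow> principal_at P" and wm: "weakly_Matlis D"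
    and T: "overring D T" and link: "t_linked D T"
  shows "w_divisorial T"
proof (cases "T = UNIV")
  case True
  have "field (ring_on (UNIV :: 'a set))"
  proof (intro field.intro field_axioms.intro)
    show "domain (ring_on (UNIV :: 'a set))" by (intro domain_ring_on) auto
    show "Units (ring_on (UNIV :: 'a set)) = carrier (ring_on UNIV) - {\<zero>\<^bsub>ring_on UNIV\<^esub>}"
    proof -
      have "\<exists>y. y * x = 1 \<and> x * y = 1" if "x \<noteq> 0" for x :: 'a
        using that by (intro exI[of _ "inverse x"]) simp
      then show ?thesis by (auto simp: Units_def)
    qed
  qed
  with True show ?thesis by (simp add: w_divisorial_def)
next
  case False
  interpret T: frac_dom T using frac_dom_overring[OF T False] .
  have DT: "D \<subseteq> T" using T by (auto simp: overring_def)
  have un: "t_primes_in_unique_t_maximal D" using wm by (simp add: weakly_Matlis_def)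
  note center = t_linked_center[OF pv T False link]
  have Q: "prime_of (N \<inter> D)" "N \<inter> D \<noteq> {0}" "D - N \<inter> D \<subseteq> T - N"
    if "N \<in> t_Max T" for N
    using prime_Int_overring[OF T False T.prime_t_max[OF that] T.t_maxD(3)[OF that]] by auto
  have QS: "N \<inter> D \<in> t_Spec D" if "N \<in> t_Max T" for N
    using Q[OF that] center(1)[OF that] by (simp add: t_Spec_iff[OF pv])
  have val: "val_at (N \<inter> D)" if N: "N \<in> t_Max T" for N
    using center(1)[OF N] pv val_at_mono by (auto simp: PvMD_iff)
  have "valuation_domain (localize T N)" if N: "N \<in> t_Max T" for N
    using val_at_iff[OF Q(1,2)[OF N]] val[OF N] center(2)[OF N] by simp
  then have pvT: "PvMD T" by (simp add: PvMD_def)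
  have prT: "T.principal_at N" if N: "N \<in> t_Max T" for N
  proof -
    obtain p where p: "p \<in> N \<inter> D" "\<And>m. m \<in> N \<inter> D \<Longrightarrow> \<exists>s\<in>D - N \<inter> D. \<exists>d\<in>D. s * m = p * d"
      using pr[OF QS[OF N]] unfolding principal_at_def by blast
    have "\<exists>s\<in>T - N. \<exists>d\<in>T. s * m = p * d" if m: "m \<in> N" for m
    proof -
      have "m \<in> localize D (N \<inter> D)"
        using m T.t_maxD(4)[OF N] T.D_subset_localize[OF T.t_maxD(5)[OF N]] center(2)[OF N] by blast
      then obtain s where s: "s \<in> D - N \<inter> D" "s * m \<in> D"
        using localize_iff primeD(5)[OF Q(1)[OF N]] by blast
      then have "s * m \<in> N \<inter> D" using T.primeD(7)[OF T.prime_t_max[OF N] _ m] DT by blast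
      then obtain t d where t: "t \<in> D - N \<inter> D" "d \<in> D" "t * (s * m) = p * d" using p(2) by blast
      then have "(t * s) * m = p * d" by (simp add: mult.assoc)
      with primeD(10)[OF Q(1)[OF N] t(1) s(1)] Q(3)[OF N] t(2) DT show ?thesis by blast
    qed
    with p(1) show ?thesis unfolding T.principal_at_def by blast
  qed
  \<comment> \<open>For n in N1 outside N2, 1 / n would be in the localization of T at N2, which the
    inclusion of centres places inside the one at N1, making n a unit there.\<close>
  have sub: "N1 \<subseteq> N2" if N: "N1 \<in> t_Max T" "N2 \<in> t_Max T" "N1 \<inter> D \<subseteq> N2 \<inter> D" for N1 N2
  proof
    fix n assume n: "n \<in> N1"
    note p1 = T.prime_t_max[OF N(1)]
    show "n \<in> N2"
    proof (rule ccontr)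
      assume "n \<notin> N2"
      then have n2: "n \<in> T - N2" using n T.primeD(9)[OF p1] by blast
      then have "1 / n \<in> localize T N2" using T.localize_quotient[OF T.t_maxD(4)[OF N(2)] T.one_mem] by blast
      then have "1 / n \<in> localize D (N1 \<inter> D)"
        using center(2)[OF N(2)] N(3) unfolding localize_def by blast
      then have "1 / n \<in> localize T N1" using center(2)[OF N(1)] by simp
      then obtain s where s: "s \<in> T - N1" "s * (1 / n) \<in> T"
        using T.localize_iff T.primeD(5)[OF p1] by blast
      then have "s * (1 / n) * n \<in> N1" using T.primeD(7)[OF p1 _ n] by blast
      with s(1) T.primeD(12)[OF T.prime_t_max[OF N(2)] n2] show False by simp
    qed
  qed
  \<comment> \<open>Primes below one M form a chain, so t-maximal ideals of T with centres in the
    same M are comparable and thus equal. Both parts of weakly Matlis are transferred from D through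
    this.\<close>
  have inj: "N1 = N2"
    if N: "N1 \<in> t_Max T" "N2 \<in> t_Max T" and M: "M \<in> t_Max D" "N1 \<inter> D \<subseteq> M" "N2 \<inter> D \<subseteq> M" for N1 N2 M
  proof -
    have "val_at M" using pv M(1) by (simp add: PvMD_iff)
    then have "N1 \<inter> D \<subseteq> N2 \<inter> D \<or> N2 \<inter> D \<subseteq> N1 \<inter> D"
      using primes_comparable Q(1) N M by blast
    with sub N T.t_max_eqI show ?thesis by metis
  qed
  have "t_primes_in_unique_t_maximal T"
    unfolding t_primes_in_unique_t_maximal_def
  proof
    fix P assume "P \<in> t_Spec T"
    then have P: "primeideal P (ring_on T)" "P \<noteq> {0}" "\<exists>N\<in>t_Max T. P \<subseteq> N"
      using T.t_Spec_iff[OF pvT] by auto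
    have "N1 = N2" if N: "N1 \<in> t_Max T" "N2 \<in> t_Max T" "P \<subseteq> N1" "P \<subseteq> N2" for N1 N2
    proof -
      obtain M1 M2 where M: "M1 \<in> t_Max D" "N1 \<inter> D \<subseteq> M1" "M2 \<in> t_Max D" "N2 \<inter> D \<subseteq> M2"
        using center(1)[OF N(1)] center(1)[OF N(2)] by blast
      have "M1 = M2"
        using N M by (intro ex_unique_t_max[OF pv un prime_Int_overring(1,2)[OF T False P(1,2)] M(1,3)]) auto
      with inj N M show ?thesis by blast
    qed
    with P(3) show "\<exists>!N. N \<in> t_Max T \<and> P \<subseteq> N" by blast
  qed
  moreover have "finite {N \<in> t_Max T. x \<in> N}" if x: "x \<in> T" "x \<noteq> 0" for x
  proof -
    obtain a b where ab: "a \<in> D" "b \<in> D" "b \<noteq> 0" "x = a / b" using quotient by blast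
    obtain g where g: "\<And>N. N \<in> t_Max T \<Longrightarrow> g N \<in> t_Max D \<and> N \<inter> D \<subseteq> g N"
      using center(1) by metis
    have "inj_on g {N \<in> t_Max T. x \<in> N}"
    proof (rule inj_onI)
      fix N1 N2 assume "N1 \<in> {N \<in> t_Max T. x \<in> N}" "N2 \<in> {N \<in> t_Max T. x \<in> N}" "g N1 = g N2"
      then show "N1 = N2" using g[of N1] g[of N2] by (intro inj[of _ _ "g N1"]) auto
    qed
    moreover have "g ` {N \<in> t_Max T. x \<in> N} \<subseteq> {M \<in> t_Max D. a \<in> M}"
    proof
      fix M assume "M \<in> g ` {N \<in> t_Max T. x \<in> N}"
      then obtain N where N: "N \<in> t_Max T" "x \<in> N" "M = g N" by blast
      then have "b * x \<in> N" using T.primeD(7)[OF T.prime_t_max[OF N(1)] _ N(2)] ab(2) DT by blast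
      then have "a \<in> N \<inter> D" using ab by simp
      with g[OF N(1)] N(3) show "M \<in> {M \<in> t_Max D. a \<in> M}" by blast
    qed
    moreover have "finite {M \<in> t_Max D. a \<in> M}"
      using wm ab x(2) by (simp add: weakly_Matlis_def)
    ultimately show ?thesis by (meson finite_imageD finite_subset)
  qed
  ultimately have "weakly_Matlis T" by (simp add: weakly_Matlis_def)
  with pvT prT show ?thesis by (intro T.w_divisorialI) auto
qed

section \<open>Minimal primes\<close>

text \<open>The radical of \<open>I D\<^sub>M\<close>, intersected with \<open>D\<close>.\<close>

definition radical_at :: "'a set \<Rightarrow> 'a set \<Rightarrow> 'a set" where
  "radical_at I M = {a\<in>D. \<exists>n. \<exists>s\<in>D - M. s * a ^ n \<in> I}"

lemma power_prime: "prime_of P \<Longrightarrow> a \<in> D \<Longrightarrow> a ^ n \<in> P \<Longrightarrow> a \<in> P"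
  by (induction n) (auto dest: primeD(3) primeD(4)[of P a "a ^ n" for n] intro: power_mem)

lemma radical_at_subset:
  assumes M: "prime_of M" and I: "I \<subseteq> M"
  shows "I \<subseteq> radical_at I M" "radical_at I M \<subseteq> M"
proof -
  show "I \<subseteq> radical_at I M"
  proof
    fix a assume a: "a \<in> I"
    then have "a \<in> D" "1 * a ^ 1 \<in> I" using I primeD(2)[OF M] by auto
    then show "a \<in> radical_at I M" unfolding radical_at_def using primeD(11)[OF M] by blast
  qed
  show "radical_at I M \<subseteq> M"
  proof
    fix a assume "a \<in> radical_at I M"
    then obtain n s where a: "a \<in> D" "s \<in> D - M" "s * a ^ n \<in> I" by (auto simp: radical_at_def)
    then have "a ^ n \<in> M" using primeD(4)[OF M, of s "a ^ n"] power_mem I by blast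
    then show "a \<in> M" using power_prime[OF M a(1)] by blast
  qed
qed

text \<open>When a is a local multiple of b, a * a is a local multiple of a * b and a + b is one of
  b; the first gives primeness, the second closure under addition.\<close>

lemma prime_radical_at:
  assumes M: "prime_of M" "val_at M" and I: "submodule_of D I" "I \<subseteq> M"
  shows "prime_of (radical_at I M)"
  unfolding primeideal_iff submodule_iff
proof (intro conjI ballI impI)
  let ?R = "radical_at I M"
  note sub = radical_at_subset[OF M(1) I(2)]
  show "0 \<in> ?R" using sub(1) submoduleD(1)[OF I(1)] by blast
  show "1 \<notin> ?R" using sub(2) primeD(3)[OF M(1)] by blast
  show "?R \<subseteq> D" by (auto simp: radical_at_def)
  show "d * a \<in> ?R" if d: "d \<in> D" and aR: "a \<in> ?R" for d a
  proof -
    obtain n s where a: "a \<in> D" "s \<in> D - M" "s * a ^ n \<in> I" using aR by (auto simp: radical_at_def)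
    have "d ^ n * (s * a ^ n) \<in> I" using submoduleD(3)[OF I(1) power_mem[OF d] a(3)] .
    then have "s * (d * a) ^ n \<in> I" by (simp add: power_mult_distrib mult_ac)
    with a d mult_mem show ?thesis unfolding radical_at_def by blast
  qed
  have pow: "u ^ n \<in> D - M" if "u \<in> D - M" for u n
    using that power_prime[OF M(1), of u n] power_mem by blast
  have sum: "a + b \<in> ?R" if ab: "a \<in> D" "b \<in> ?R" and u: "u \<in> D - M" "r \<in> D" "u * a = r * b" for a b u r
  proof -
    obtain n s where b: "b \<in> D" "s \<in> D - M" "s * b ^ n \<in> I" using ab(2) by (auto simp: radical_at_def)
    have "u * (a + b) = (r + u) * b" using u(3) by (simp add: algebra_simps)
    then have "u ^ n * (a + b) ^ n = (r + u) ^ n * b ^ n" by (metis power_mult_distrib)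
    then have "(u ^ n * s) * (a + b) ^ n = (r + u) ^ n * (s * b ^ n)" by (simp add: mult_ac)
    moreover have "(r + u) ^ n * (s * b ^ n) \<in> I"
      using u by (intro submoduleD(3)[OF I(1) _ b(3)] power_mem add_mem) auto
    ultimately have "(u ^ n * s) * (a + b) ^ n \<in> I" by (simp only:)
    then show ?thesis
      using primeD(10)[OF M(1) pow[OF u(1)] b(2)] add_mem[OF ab(1) b(1)]
      unfolding radical_at_def by blast
  qed
  show "a + b \<in> ?R" if ab: "a \<in> ?R" "b \<in> ?R" for a b
  proof -
    have D: "a \<in> D" "b \<in> D" using ab by (auto simp: radical_at_def)
    show ?thesis
    proof (rule val_atE[OF M(2), of a b])
      fix u r assume "u \<in> D - M" "r \<in> D" "u * a = r * b"
      with sum[OF D(1) ab(2)] show ?thesis .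
    next
      fix u r assume "u \<in> D - M" "r \<in> D" "u * b = r * a"
      with sum[OF D(2) ab(1)] show ?thesis by (simp add: add.commute)
    qed
  qed
  have half: "a \<in> ?R" if ab: "a \<in> D" "b \<in> D" "a * b \<in> ?R" and u: "u \<in> D - M" "r \<in> D" "u * a = r * b" for a b u r
  proof -
    obtain n s where s: "s \<in> D - M" "s * (a * b) ^ n \<in> I" using ab(3) by (auto simp: radical_at_def)
    have "(u ^ n * s) * a ^ (n + n) = s * a ^ n * (u * a) ^ n"
      by (simp add: power_mult_distrib power_add mult_ac)
    also have "\<dots> = r ^ n * (s * (a * b) ^ n)" unfolding u(3) by (simp add: power_mult_distrib mult_ac)
    also have "\<dots> \<in> I" using submoduleD(3)[OF I(1) power_mem[OF u(2)] s(2)] .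
    finally show ?thesis
      using primeD(10)[OF M(1) pow[OF u(1)] s(1)] ab(1) unfolding radical_at_def by blast
  qed
  show "a \<in> ?R \<or> b \<in> ?R" if ab: "a \<in> D" "b \<in> D" "a * b \<in> ?R" for a b
  proof (rule val_atE[OF M(2), of a b])
    fix u r assume "u \<in> D - M" "r \<in> D" "u * a = r * b"
    with half[OF ab] show ?thesis by blast
  next
    fix u r assume "u \<in> D - M" "r \<in> D" "u * b = r * a"
    moreover have "b * a \<in> ?R" using ab(3) by (simp add: mult.commute)
    ultimately show ?thesis using half[OF ab(2,1)] by blast
  qed
qed

lemma radical_at_minimal:
  assumes M: "prime_of M" and I: "I \<subseteq> M"
    and Q: "prime_of Q" "I \<subseteq> Q" "Q \<subseteq> radical_at I M"
  shows "Q = radical_at I M"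
proof
  show "radical_at I M \<subseteq> Q"
  proof
    fix a assume "a \<in> radical_at I M"
    then obtain n s where a: "a \<in> D" "s \<in> D - M" "s * a ^ n \<in> I" by (auto simp: radical_at_def)
    have "s \<in> D - Q" using a(2) Q(3) radical_at_subset(2)[OF M I] by blast
    then have "a ^ n \<in> Q" using primeD(4)[OF Q(1), of s "a ^ n"] a Q(2) power_mem by blast
    then show "a \<in> Q" using power_prime[OF Q(1) a(1)] by blast
  qed
qed (rule Q(3))

lemma radical_at_minimal_primes:
  "prime_of M \<Longrightarrow> val_at M \<Longrightarrow> submodule_of D I \<Longrightarrow> I \<subseteq> M \<Longrightarrow> radical_at I M \<in> minimal_primes D I"
  using prime_radical_at radical_at_subset(1) radical_at_minimal
  by (simp add: minimal_primes_def)

text \<open>A minimal prime P contains, hence equals, one of finitely many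
  \<open>radical_at I M\<close>. Otherwise some a outside P lies in all of them; a power of a is
  then locally in I at every t-maximal ideal, so it is in I_t = I and therefore in P.\<close>

theorem finite_minimal_primes:
  assumes pv: "PvMD D" and wm: "weakly_Matlis D" and I: "t_ideal D I" "I \<subseteq> D"
  shows "finite (minimal_primes D I)"
proof -
  note sI = t_idealD(1)[OF I(1)]
  define T where "T = {M \<in> t_Max D. I \<subseteq> M}"
  obtain x where x: "x \<in> I" "x \<noteq> 0" using t_idealD(2)[OF I(1)] submoduleD(1)[OF sI] by blast
  have "finite {M \<in> t_Max D. x \<in> M}" using wm x I(2) by (auto simp: weakly_Matlis_def)
  moreover have "T \<subseteq> {M \<in> t_Max D. x \<in> M}" using x by (auto simp: T_def)
  ultimately have fin: "finite T" by (rule finite_subset[rotated])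
  have pr: "prime_of (radical_at I M)" if "M \<in> T" for M
    using that pv by (intro prime_radical_at sI prime_t_max) (auto simp: T_def PvMD_iff)
  have "minimal_primes D I \<subseteq> radical_at I ` T"
  proof
    fix P assume "P \<in> minimal_primes D I"
    then have P: "prime_of P" "I \<subseteq> P" "\<And>Q. prime_of Q \<Longrightarrow> I \<subseteq> Q \<Longrightarrow> Q \<subseteq> P \<Longrightarrow> Q = P"
      by (auto simp: minimal_primes_def)
    have "\<exists>M\<in>T. radical_at I M \<subseteq> P"
    proof (rule ccontr)
      assume no: "\<not> (\<exists>M\<in>T. radical_at I M \<subseteq> P)"
      have "\<exists>a\<in>D - P. \<forall>M\<in>T. a \<in> radical_at I M"
      proof (rule ex_avoiding_prime[OF P(1) fin])
        fix M assume "M \<in> T"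
        then show "submodule_of D (radical_at I M)" using pr primeD(1) by blast
        have "radical_at I M \<subseteq> D" by (auto simp: radical_at_def)
        with \<open>M \<in> T\<close> no show "\<exists>c\<in>D - P. c \<in> radical_at I M" by blast
      qed
      then obtain a where a: "a \<in> D - P" "\<And>M. M \<in> T \<Longrightarrow> a \<in> radical_at I M" by blast
      have "\<forall>M\<in>T. \<exists>n s. s \<in> D - M \<and> s * a ^ n \<in> I"
        using a(2) unfolding radical_at_def by blast
      then obtain n s where ns: "\<And>M. M \<in> T \<Longrightarrow> s M \<in> D - M \<and> s M * a ^ n M \<in> I"
        by metis
      \<comment> \<open>The sum of the exponents works at all M in \<open>T\<close> simultaneously;
        where I is not contained in M, an element of I outside M serves as s.\<close>
      have "\<exists>s\<in>D - M. s * a ^ sum n T \<in> I" if M: "M \<in> t_Max D" for M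
      proof (cases "M \<in> T")
        case True
        then have "sum n T = n M + sum n (T - {M})" using fin by (simp add: sum.remove)
        then have "s M * a ^ sum n T = a ^ sum n (T - {M}) * (s M * a ^ n M)"
          by (simp add: power_add mult_ac)
        with ns[OF True] submoduleD(3)[OF sI power_mem] a(1) show ?thesis by (metis DiffD1)
      next
        case False
        then obtain c where "c \<in> I" "c \<in> D - M" using M I(2) by (auto simp: T_def)
        with submoduleD(4)[OF sI power_mem[of a]] a(1) show ?thesis by blast
      qed
      then have "a ^ sum n T \<in> I"
        using locally_in_v_closure[OF sI] t_idealD(3)[OF I(1)] by blast
      then show False using power_prime[OF P(1)] P(2) a(1) by blast
    qed
    then obtain M where M: "M \<in> T" "radical_at I M \<subseteq> P" by blast
    have "I \<subseteq> radical_at I M" using M(1) prime_t_max by (intro radical_at_subset) (auto simp: T_def)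
    with P(3)[OF pr[OF M(1)] _ M(2)] M(1) show "P \<in> radical_at I ` T" by blast
  qed
  with fin show ?thesis using finite_surj by blast
qed

text \<open>With I = x D, sending M to \<open>radical_at I M\<close> embeds the t-maximal ideals
  containing x into the minimal primes of I: a nonzero prime below M determines M.\<close>

theorem finite_character:
  assumes pv: "PvMD D" and un: "t_primes_in_unique_t_maximal D"
    and fin: "\<And>I. t_ideal D I \<Longrightarrow> I \<subseteq> D \<Longrightarrow> finite (minimal_primes D I)"
    and x: "x \<in> D" "x \<noteq> 0"
  shows "finite {M \<in> t_Max D. x \<in> M}"
proof -
  define I where "I = (*) x ` D"
  have I: "t_ideal D I" unfolding I_def by (rule t_ideal_principal[OF x])
  note sI = t_idealD(1)[OF I]
  have ID: "I \<subseteq> D" using x mult_mem by (auto simp: I_def)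
  have xI: "x \<in> I" unfolding I_def by (rule image_eqI[of _ _ 1]) auto
  have IM: "I \<subseteq> M" if "M \<in> t_Max D" "x \<in> M" for M
    using submoduleD(4)[OF t_maxD(2)[OF that(1)] _ that(2)] by (auto simp: I_def)
  have val: "val_at M" if "M \<in> t_Max D" for M using pv that by (simp add: PvMD_iff)
  note pr = prime_radical_at[OF prime_t_max val sI IM]
  have "inj_on (radical_at I) {M \<in> t_Max D. x \<in> M}"
  proof (rule inj_onI)
    fix M N assume M: "M \<in> {M \<in> t_Max D. x \<in> M}" and N: "N \<in> {M \<in> t_Max D. x \<in> M}"
      and eq: "radical_at I M = radical_at I N"
    have "radical_at I M \<noteq> {0}"
      using radical_at_subset(1)[OF prime_t_max IM] M xI x(2) by blast
    moreover have "radical_at I M \<subseteq> M" "radical_at I M \<subseteq> N"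
      using radical_at_subset(2)[OF prime_t_max IM] M N eq by blast+
    ultimately show "M = N" using ex_unique_t_max[OF pv un pr] M N by blast
  qed
  moreover have "radical_at I ` {M \<in> t_Max D. x \<in> M} \<subseteq> minimal_primes D I"
    using radical_at_minimal_primes[OF prime_t_max val sI IM] by blast
  ultimately show ?thesis using fin[OF I ID] by (meson finite_imageD finite_subset)
qed

end

text \<open>Condition (1) is the hub: it is linked with (2) and with (6) in both directions, and
  with (3) and (4) by the cycle (1), (4), (3), (1).\<close>

theorem theorem3p5:
  fixes R :: "'a::field set"
  assumes "domain (ring_on R)" and "has_quotient_field R" and "R \<noteq> UNIV"
  shows
    "(strongly_discrete_PvMD R \<and> weakly_Matlis R
        \<longleftrightarrow> integrally_closed R \<and> strongly_w_divisorial R) \<and>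
     (integrally_closed R \<and> strongly_w_divisorial R
        \<longleftrightarrow> integrally_closed R \<and> (\<forall>T. overring R T \<and> t_flat R T \<longrightarrow> w_divisorial T)) \<and>
     (integrally_closed R \<and> (\<forall>T. overring R T \<and> t_flat R T \<longrightarrow> w_divisorial T)
        \<longleftrightarrow> integrally_closed R \<and> (\<forall>T. overring R T \<and> t_linked R T \<longrightarrow> w_divisorial T)) \<and>
     (integrally_closed R \<and> (\<forall>T. overring R T \<and> t_linked R T \<longrightarrow> w_divisorial T)
        \<longleftrightarrow> w_divisorial R \<and> generalized_Krull R) \<and>
     (w_divisorial R \<and> generalized_Krull R
        \<longleftrightarrow> generalized_Krull R \<and> t_primes_in_unique_t_maximal R)"
    (is "(?c1 \<longleftrightarrow> ?c2) \<and> (_ \<longleftrightarrow> ?c3) \<and> (_ \<longleftrightarrow> ?c4) \<and> (_ \<longleftrightarrow> ?c5) \<and> (_ \<longleftrightarrow> ?c6)")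
proof -
  interpret frac_dom R
    using assms by (intro frac_domI) (auto simp: domain_def cring_def)
  have val: "prime_of P" "P \<noteq> {0}" "val_at P" if "PvMD R" "P \<in> t_Spec R" for P
    using that t_Spec_iff[OF that(1)] val_at_mono by (auto simp: PvMD_iff)
  \<comment> \<open>Combined with (6), this gives (5) from (1); the way back from (5) passes through
    (6).\<close>
  have wd: "w_divisorial R" if ?c1
    using that t_Max_subset_t_Spec by (intro w_divisorialI) (auto simp: strongly_discrete_PvMD_iff)
  have "?c2" if ?c1
    using that wd[OF that] val divisorial_localize
    by (auto simp: strongly_w_divisorial_def strongly_discrete_PvMD_iff intro: PvMD_imp_integrally_closed)
  moreover have "?c1" if ?c2
  proof -
    from that have w: "w_divisorial R" and pv: "PvMD R"
      using w_divisorial_integrally_closed_imp_PvMD by (auto simp: strongly_w_divisorial_def)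
    have "principal_at P" if "P \<in> t_Spec R" for P
      using \<open>?c2\<close> that val[OF pv that] principal_at_if_divisorial
      by (auto simp: strongly_w_divisorial_def)
    with pv weakly_Matlis_if_w_divisorial[OF pv w] show ?thesis
      by (simp add: strongly_discrete_PvMD_iff)
  qed
  moreover have "?c4" if ?c1
    using that t_linked_w_divisorial PvMD_imp_integrally_closed
    by (auto simp: strongly_discrete_PvMD_iff)
  moreover have "?c3" if ?c4
    using that t_flat_imp_t_linked by blast
  moreover have "?c1" if ?c3
  proof -
    \<comment> \<open>The t-flat overrings tested are R itself and, below, its localizations at
      t-primes.\<close>
    have "overring R R" using ring_D by (simp add: overring_def)
    with that t_flat_self have w: "w_divisorial R" by blast
    with that have pv: "PvMD R" using w_divisorial_integrally_closed_imp_PvMD by blast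
    have "principal_at P" if P: "P \<in> t_Spec R" for P
    proof -
      note P' = val[OF pv P]
      have "w_divisorial (localize R P)"
        using \<open>?c3\<close> overring_localize t_flat_localize P' by blast
      with principal_at_if_w_divisorial[OF P'] show ?thesis by blast
    qed
    with pv weakly_Matlis_if_w_divisorial[OF pv w] show ?thesis
      by (simp add: strongly_discrete_PvMD_iff)
  qed
  moreover have "?c6" if ?c1
    using that finite_minimal_primes
    by (auto simp: generalized_Krull_def strongly_discrete_PvMD_def weakly_Matlis_def)
  moreover have "?c1" if ?c6
    using that finite_character
    by (auto simp: generalized_Krull_def strongly_discrete_PvMD_def weakly_Matlis_def)
  moreover have "?c6" if ?c5
    using that w_divisorial_imp_unique_t_max
    by (auto simp: generalized_Krull_def strongly_discrete_PvMD_def)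
  ultimately show ?thesis using wd by blast
qed

end
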